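(* Let $P\subset\mathbb{R}^d$ be a polytope and $c\in\mathbb{R}^d$ a generic objective function. Then the monotone path polytope $\Sigma_c(P)$ is a weak Minkowski summand of the max-slope pivot rule polytope $\Pi^{\mathrm{MS}}_{P,c}$. If $P$ is a zonotope, then $\Sigma_c(P)$ is normally equivalent to $\Pi^{\mathrm{MS}}_{P,c}$.
   Context: For a polytope $P\subset\mathbb{R}^d$, $V(P)$ denotes its vertex set and $E(P)$ its edges. $c\in\mathbb{R}^d$ is generic for $P$ if $c^tu\neq c^tv$ for all edges $uv$; then $c$ has a unique maximizing vertex $v_{opt}$ and a unique minimizing vertex $v_{-opt}$. $\mathrm{Nb}_{P,c}(v)=\{u : uv\in E(P),\ c^tu>c^tv\}$. A $c$-arborescence is a map $\mathcal{A}:V(P)\to V(P)$ with $\mathcal{A}(v_{opt})=v_{opt}$ and $\mathcal{A}(v)\in\mathrm{Nb}_{P,c}(v)$ for $v\ne v_{opt}$. The max-slope pivot rule polytope is $$\Pi^{\mathrm{MS}}_{P,c}=\operatorname{conv}\left\{\sum_{v\ne v_{opt}}\frac{\mathcal{A}(v)-v}{c^t(\mathcal{A}(v)-v)} : \mathcal{A}\text{ a }c\text{-arborescence}\right\}.$$ A monotone path is a sequence $W=(v_0,v_1,\dots,v_k)$ of vertices with $v_0=v_{-opt}$, $v_k=v_{opt}$ and $v_i\in\mathrm{Nb}_{P,c}(v_{i-1})$ for all $i$. Set $$\Phi_W=\sum_{i=1}^k\frac{c^t(v_i-v_{i-1})}{c^t(v_k-v_0)}\cdot\frac{v_i+v_{i-1}}{2}.$$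 The monotone path polytope is $\Sigma_c(P)=\operatorname{conv}\{\Phi_W : W\text{ a monotone path of }(P,c)\}$. A polytope $Q\subset\mathbb{R}^d$ is a weak Minkowski summand of a polytope $P\subset\mathbb{R}^d$ if there are $\lambda>0$ and a polytope $R\subset\mathbb{R}^d$ with $\lambda P=Q+R$. Two polytopes are normally equivalent if each is a weak Minkowski summand of the other. A zonotope is a translate of a polytope of the form $[-z_1,z_1]+\cdots+[-z_n,z_n]$ with $z_i\in\mathbb{R}^d$. *)

theory Defs
  imports "HOL-Analysis.Analysis" "HOL-Library.Set_Algebras"
begin

text \<open>
  Edges are the faces of affine dimension 1; the edge between the vertices \<open>u\<close> and \<open>v\<close> is
  \<open>closed_segment u v\<close>. Conversely, if \<open>closed_segment u v edge_of P\<close>, then \<open>u\<close> and \<open>v\<close> are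
  automatically distinct vertices of \<open>P\<close>.
  Sums of sets are Minkowski sums.
\<close>

definition vertices :: "'a::euclidean_space set \<Rightarrow> 'a set" where
  "vertices P = {v. v extreme_point_of P}"

definition generic_for :: "'a::euclidean_space set \<Rightarrow> 'a \<Rightarrow> bool" where
  "generic_for P c \<longleftrightarrow> (\<forall>u v. closed_segment u v edge_of P \<longrightarrow> c \<bullet> u \<noteq> c \<bullet> v)"

text \<open>The next two are meaningful only for a nonempty polytope \<open>P\<close> and generic \<open>c\<close>, where the
  optimal vertex exists and is unique.\<close>

definition opt_vertex :: "'a::euclidean_space set \<Rightarrow> 'a \<Rightarrow> 'a" where
  "opt_vertex P c = (THE v. v \<in> vertices P \<and> (\<forall>x\<in>P. c \<bullet> x \<le> c \<bullet> v))"

definition min_vertex :: "'a::euclidean_space set \<Rightarrow> 'a \<Rightarrow> 'a" where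
  "min_vertex P c = (THE v. v \<in> vertices P \<and> (\<forall>x\<in>P. c \<bullet> v \<le> c \<bullet> x))"

definition improving_nbs :: "'a::euclidean_space set \<Rightarrow> 'a \<Rightarrow> 'a \<Rightarrow> 'a set" where
  "improving_nbs P c v = {u \<in> vertices P. closed_segment u v edge_of P \<and> c \<bullet> u > c \<bullet> v}"

text \<open>An arborescence is a map on the vertices; its values elsewhere are irrelevant.\<close>

definition arborescence :: "'a::euclidean_space set \<Rightarrow> 'a \<Rightarrow> ('a \<Rightarrow> 'a) \<Rightarrow> bool" where
  "arborescence P c A \<longleftrightarrow>
     A (opt_vertex P c) = opt_vertex P c \<and>
     (\<forall>v \<in> vertices P - {opt_vertex P c}. A v \<in> improving_nbs P c v)"

definition max_slope_polytope :: "'a::euclidean_space set \<Rightarrow> 'a \<Rightarrow> 'a set" where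
  "max_slope_polytope P c =
     convex hull
       {\<Sum>v \<in> vertices P - {opt_vertex P c}. (1 / (c \<bullet> (A v - v))) *\<^sub>R (A v - v) | A.
          arborescence P c A}"

text \<open>A path \<open>(v\<^sub>0, \<dots>, v\<^sub>k)\<close> is a list of length \<open>k + 1\<close>.\<close>

definition monotone_path :: "'a::euclidean_space set \<Rightarrow> 'a \<Rightarrow> 'a list \<Rightarrow> bool" where
  "monotone_path P c W \<longleftrightarrow>
     W \<noteq> [] \<and> set W \<subseteq> vertices P \<and> hd W = min_vertex P c \<and> last W = opt_vertex P c \<and>
     (\<forall>i \<in> {1..<length W}. W ! i \<in> improving_nbs P c (W ! (i - 1)))"

definition path_point :: "'a::euclidean_space \<Rightarrow> 'a list \<Rightarrow> 'a" where
  "path_point c W =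
     (\<Sum>i \<in> {1..<length W}.
        (c \<bullet> (W ! i - W ! (i - 1)) / (c \<bullet> (last W - hd W))) *\<^sub>R
          ((1 / 2) *\<^sub>R (W ! i + W ! (i - 1))))"

definition monotone_path_polytope :: "'a::euclidean_space set \<Rightarrow> 'a \<Rightarrow> 'a set" where
  "monotone_path_polytope P c = convex hull {path_point c W | W. monotone_path P c W}"

text \<open>Summands are nonempty; note that \<^const>\<open>polytope\<close> also holds of the empty set.\<close>

definition weak_minkowski_summand :: "'a::euclidean_space set \<Rightarrow> 'a set \<Rightarrow> bool" where
  "weak_minkowski_summand Q P \<longleftrightarrow>
     polytope Q \<and> polytope P \<and>
     (\<exists>r>0. \<exists>R. polytope R \<and> R \<noteq> {} \<and> (\<lambda>x. r *\<^sub>R x) ` P = Q + R)"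

definition normally_equivalent :: "'a::euclidean_space set \<Rightarrow> 'a set \<Rightarrow> bool" where
  "normally_equivalent P Q \<longleftrightarrow> weak_minkowski_summand P Q \<and> weak_minkowski_summand Q P"

definition zonotope :: "'a::euclidean_space set \<Rightarrow> bool" where
  "zonotope P \<longleftrightarrow>
     (\<exists>n::nat. \<exists>z :: nat \<Rightarrow> 'a. \<exists>t.
        P = (+) t ` (\<Sum>i<n. closed_segment (- z i) (z i)))"

end

theory Submission
  imports Defs
begin

text \<open>
  The max-slope polytope in direction \<open>w\<close> is maximised by the arborescences that at every vertex
  choose a neighbour of maximal \<open>w\<close>-slope. The value of \<open>w\<close> at \<open>path_point c W\<close> is, up to
  normalisation, the area under the projection of \<open>W\<close> to the plane by
  \<open>x \<mapsto> (c \<bullet> x, w \<bullet> x)\<close>, and the path following a steepest arborescence projects to the upper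
  boundary of the projection of \<open>P\<close>, so it maximises this area. Hence the normal fan of the
  max-slope polytope refines that of the monotone path polytope.

  For a zonotope every steepest path of a generic \<open>w'\<close> uses every edge direction, in decreasing order
  of the \<open>w'\<close>-slopes. If such a path is also optimal for \<open>w\<close>, then the \<open>w\<close>-slopes decrease along it,
  so the order of all edge directions by \<open>w\<close>-slope agrees weakly with the order by \<open>w'\<close>-slope, and
  the arborescence of \<open>w'\<close> is steepest for \<open>w\<close>. This gives the converse refinement.
\<close>

section \<open>Perturbation, continuity and trapezoid integrals\<close>

text \<open>The required strict inequalities cut out an open set \<open>U\<close> containing
  \<open>w\<close>, while ties between distinct elements of \<open>D\<close> occur only on the
  finite union \<open>N\<close> of hyperplanes. An open nonempty set is not negligible, so it is not
  covered by \<open>N\<close>.\<close>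

lemma exists_regular_perturbation:
  fixes D :: "'a::euclidean_space set"
  assumes "finite D"
  shows "\<exists>w'. inj_on (\<lambda>d. w' \<bullet> d) D \<and> (\<forall>d\<in>D. \<forall>e\<in>D. w \<bullet> d < w \<bullet> e \<longrightarrow> w' \<bullet> d < w' \<bullet> e)"
proof -
  define Q where "Q = {(d, e) \<in> D \<times> D. w \<bullet> d < w \<bullet> e}"
  define U where "U = (\<Inter>q\<in>Q. {x. x \<bullet> fst q < x \<bullet> snd q})"
  define N where "N = (\<Union>q\<in>{(d, e) \<in> D \<times> D. d \<noteq> e}. {x. (fst q - snd q) \<bullet> x = 0})"
  have fin: "finite (D \<times> D)" using assms by simp
  have "finite Q" by (rule finite_subset[OF _ fin]) (auto simp: Q_def)
  then have "open U"
    unfolding U_def by (intro open_INT ballI open_Collect_less continuous_intros)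
  moreover have "w \<in> U" by (auto simp: U_def Q_def)
  ultimately have "\<not> negligible U" using open_not_negligible by blast
  moreover have "finite {(d, e) \<in> D \<times> D. d \<noteq> e}" by (rule finite_subset[OF _ fin]) auto
  then have "negligible N"
    unfolding N_def by (intro negligible_Union finite_imageI) (auto intro!: negligible_hyperplane)
  ultimately have "\<not> U \<subseteq> N" using negligible_subset by blast
  then obtain w' where w': "w' \<in> U" "w' \<notin> N" by blast
  have "inj_on (\<lambda>d. w' \<bullet> d) D"
  proof (rule inj_onI, rule ccontr)
    fix d e assume de: "d \<in> D" "e \<in> D" "w' \<bullet> d = w' \<bullet> e" "d \<noteq> e"
    then have "(fst (d, e) - snd (d, e)) \<bullet> w' = 0"
      by (simp add: inner_commute[of _ w'] inner_diff_right)
    then have "w' \<in> N" unfolding N_def using de by blast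
    then show False using w'(2) by simp
  qed
  moreover have "\<forall>d\<in>D. \<forall>e\<in>D. w \<bullet> d < w \<bullet> e \<longrightarrow> w' \<bullet> d < w' \<bullet> e"
    using w'(1) by (auto simp: U_def Q_def)
  ultimately show ?thesis by blast
qed

lemma continuous_on_Min:
  fixes f :: "'i \<Rightarrow> 'a::topological_space \<Rightarrow> real"
  assumes "finite I" "I \<noteq> {}" "\<And>i. i \<in> I \<Longrightarrow> continuous_on S (f i)"
  shows "continuous_on S (\<lambda>t. Min ((\<lambda>i. f i t) ` I))"
  using assms
proof (induction I rule: finite_ne_induct)
  case (insert i I)
  then have "continuous_on S (\<lambda>t. min (f i t) (Min ((\<lambda>i. f i t) ` I)))"
    by (intro continuous_on_min) auto
  then show ?case using insert.hyps by simp
qed simp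

lemma has_integral_affine:
  fixes a b p s :: real
  assumes "a \<le> b"
  shows "((\<lambda>t. p + s * (t - a)) has_integral (b - a) * (p + (p + s * (b - a))) / 2) {a..b}"
proof -
  let ?F = "\<lambda>t. p * t + s * (t - a)\<^sup>2 / 2"
  have int: "((\<lambda>t. p + s * (t - a)) has_integral (?F b - ?F a)) {a..b}"
    by (rule fundamental_theorem_of_calculus[OF assms])
      (auto intro!: derivative_eq_intros simp flip: has_real_derivative_iff_has_vector_derivative)
  have eq: "?F b - ?F a = (b - a) * (p + (p + s * (b - a))) / 2"
    by (simp add: power2_eq_square field_simps)
  show ?thesis using int unfolding eq .
qed

lemma antimono_upto:
  fixes s :: "nat \<Rightarrow> real"
  assumes "\<And>i. Suc i < n \<Longrightarrow> s (Suc i) \<le> s i" and "i \<le> j" "j < n"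
  shows "s j \<le> s i"
  using assms(2,3)
proof (induction j rule: dec_induct)
  case (step j)
  then show ?case using assms(1)[of j] by simp
qed simp

subsection \<open>Minkowski summands of polytopes\<close>

text \<open>A finitely generated convex cone is closed, so a point outside it can be strictly
  separated from it. The normal of the separating hyperplane is nonnegative on all generators and
  negative on \<open>z\<close>.\<close>

lemma farkas:
  fixes f :: "'i \<Rightarrow> 'a::euclidean_space"
  assumes "finite I" and "\<And>w. (\<And>k. k \<in> I \<Longrightarrow> 0 \<le> w \<bullet> f k) \<Longrightarrow> 0 \<le> w \<bullet> z"
  shows "\<exists>m. (\<forall>k. 0 \<le> m k) \<and> z = (\<Sum>k\<in>I. m k *\<^sub>R f k)"
proof -
  define K where "K x \<longleftrightarrow> (\<exists>m. (\<forall>k. 0 \<le> m k) \<and> x = (\<Sum>k\<in>I. m k *\<^sub>R f k))" for x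
  have add: "K (x + y)" if x: "K x" and y: "K y" for x y
  proof -
    obtain m where m: "\<forall>k. 0 \<le> m k" "x = (\<Sum>k\<in>I. m k *\<^sub>R f k)"
      using x unfolding K_def by (elim exE conjE)
    obtain n where n: "\<forall>k. 0 \<le> n k" "y = (\<Sum>k\<in>I. n k *\<^sub>R f k)"
      using y unfolding K_def by (elim exE conjE)
    have "x + y = (\<Sum>k\<in>I. (m k + n k) *\<^sub>R f k)"
      using m n by (simp add: scaleR_left_distrib sum.distrib)
    then show ?thesis unfolding K_def using m n by (intro exI[of _ "\<lambda>k. m k + n k"]) auto
  qed
  have scale: "K (t *\<^sub>R x)" if x: "K x" and t: "0 \<le> t" for x t
  proof -
    obtain m where m: "\<forall>k. 0 \<le> m k" "x = (\<Sum>k\<in>I. m k *\<^sub>R f k)"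
      using x unfolding K_def by (elim exE conjE)
    then have "t *\<^sub>R x = (\<Sum>k\<in>I. (t * m k) *\<^sub>R f k)"
      by (simp add: scaleR_sum_right)
    then show ?thesis unfolding K_def using m t by (intro exI[of _ "\<lambda>k. t * m k"]) auto
  qed
  have "K 0" unfolding K_def by (rule exI[of _ "\<lambda>_. 0"]) simp
  then have cone: "convex_cone {x. K x}"
    using add scale unfolding convex_cone_iff by simp
  have gen: "K (f k)" if k: "k \<in> I" for k
  proof -
    have "f k = (\<Sum>j\<in>I. (if j = k then 1 else 0) *\<^sub>R f j)"
      using k assms(1) by (simp add: if_distrib[of "\<lambda>t. t *\<^sub>R _"] sum.delta cong: if_cong)
    then show ?thesis unfolding K_def by (intro exI[of _ "\<lambda>j. if j = k then 1 else 0"]) auto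
  qed
  let ?C = "convex_cone hull (f ` I)"
  have "z \<in> ?C"
  proof (rule ccontr)
    assume "z \<notin> ?C"
    moreover have "convex ?C" "closed ?C"
      using assms(1) by (auto simp: convex_convex_cone_hull closed_convex_cone_hull)
    ultimately obtain w b where w: "w \<bullet> z < b" "\<And>x. x \<in> ?C \<Longrightarrow> b < w \<bullet> x"
      using separating_hyperplane_closed_point by metis
    have "b < 0" using w(2)[OF convex_cone_hull_contains_0] by simp
    have "0 \<le> w \<bullet> f k" if "k \<in> I" for k
    proof (rule ccontr)
      assume neg: "\<not> 0 \<le> w \<bullet> f k"
      \<comment> \<open>A generator with negative value could be scaled within the cone until
        \<open>w\<close> takes exactly the value \<open>b\<close> on it, contradicting strict
        separation.\<close>
      have "f k \<in> ?C" using that by (simp add: hull_inc)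
      then have "(b / (w \<bullet> f k)) *\<^sub>R f k \<in> ?C"
        using neg \<open>b < 0\<close> by (intro convex_cone_hull_mul) (auto simp: divide_nonpos_neg)
      from w(2)[OF this] neg show False by simp
    qed
    then show False using assms(2)[of w] w(1) \<open>b < 0\<close> by fastforce
  qed
  also have "?C \<subseteq> {x. K x}"
    by (rule hull_minimal) (use gen cone in auto)
  finally show ?thesis by (simp add: K_def)
qed

definition maximizes :: "'a::real_inner \<Rightarrow> 'a set \<Rightarrow> 'a \<Rightarrow> bool" where
  "maximizes w X x \<longleftrightarrow> x \<in> X \<and> (\<forall>y\<in>X. w \<bullet> y \<le> w \<bullet> x)"

lemma maximizes_convex_hull:
  "maximizes w X x \<Longrightarrow> y \<in> convex hull X \<Longrightarrow> w \<bullet> y \<le> w \<bullet> x"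
  using hull_minimal[of X "{y. w \<bullet> y \<le> w \<bullet> x}" convex] convex_halfspace_le
  unfolding maximizes_def by blast

text \<open>A point of \<open>K\<close> outside \<open>L\<close> would be separated from
  \<open>L\<close> by some normal \<open>a\<close>, and would then beat all of \<open>L\<close> in
  direction \<open>- a\<close>.\<close>

lemma subset_if_support_le:
  fixes K L :: "'a::euclidean_space set"
  assumes "convex L" "closed L" and "\<And>w x. x \<in> K \<Longrightarrow> \<exists>y\<in>L. w \<bullet> x \<le> w \<bullet> y"
  shows "K \<subseteq> L"
proof
  fix x assume "x \<in> K"
  show "x \<in> L"
  proof (rule ccontr)
    assume "x \<notin> L"
    then obtain a b where "a \<bullet> x < b" "\<forall>y\<in>L. b < a \<bullet> y"
      using separating_hyperplane_closed_point assms by metis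
    moreover obtain y where "y \<in> L" "(- a) \<bullet> x \<le> (- a) \<bullet> y"
      using assms(3)[OF \<open>x \<in> K\<close>] by blast
    ultimately show False by fastforce
  qed
qed

text \<open>Shephard's criterion, in the form that a refinement of normal fans yields a summand. The
  relation \<open>S\<close> picks for every direction matching maximisers; the complementary summand is the
  convex hull of the points \<open>r *\<^sub>R x - y\<close> for a large \<open>r\<close>.\<close>

lemma weak_minkowski_summandI:
  fixes X Y :: "'a::euclidean_space set"
  assumes fin: "finite X" "finite Y" and sub: "S \<subseteq> X \<times> Y"
    and cov: "\<And>w. \<exists>(x, y)\<in>S. maximizes w X x \<and> maximizes w Y y"
    and refines: "\<And>w x y. (x, y) \<in> S \<Longrightarrow> maximizes w X x \<Longrightarrow> maximizes w Y y"
  shows "weak_minkowski_summand (convex hull Y) (convex hull X)"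
proof -
  have "finite S" using fin sub finite_subset by blast
  \<comment> \<open>By \<open>refines\<close>, every direction in the normal cone of
    \<open>fst p\<close> also maximises \<open>snd p\<close> over \<open>Y\<close>, so Farkas
    expresses the difference by the generators \<open>fst p - k\<close> of the dual cone.\<close>
  have "\<exists>m. (\<forall>k. 0 \<le> m k) \<and> snd p - snd q = (\<Sum>k\<in>X. m k *\<^sub>R (fst p - k))"
    if pq: "p \<in> S" "q \<in> S" for p q
  proof (rule farkas[OF fin(1)])
    fix w assume "\<And>k. k \<in> X \<Longrightarrow> 0 \<le> w \<bullet> (fst p - k)"
    then have "maximizes w X (fst p)"
      using sub pq by (auto simp: maximizes_def inner_diff_right)
    then have "maximizes w Y (snd p)" using refines pq by (metis prod.collapse)
    then show "0 \<le> w \<bullet> (snd p - snd q)"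
      using sub pq by (auto simp: maximizes_def inner_diff_right)
  qed
  then obtain m where m0: "\<And>p q k. p \<in> S \<Longrightarrow> q \<in> S \<Longrightarrow> 0 \<le> m p q k"
    and m: "\<And>p q. p \<in> S \<Longrightarrow> q \<in> S \<Longrightarrow> snd p - snd q = (\<Sum>k\<in>X. m p q k *\<^sub>R (fst p - k))"
    by metis
  \<comment> \<open>Large enough to dominate the coefficient sum of every pair; the summand 1 makes
    it positive even if all coefficients vanish.\<close>
  define r where "r = 1 + (\<Sum>p\<in>S. \<Sum>q\<in>S. \<Sum>k\<in>X. m p q k)"
  have r: "(\<Sum>k\<in>X. m p q k) \<le> r" if "p \<in> S" "q \<in> S" for p q
  proof -
    have "(\<Sum>k\<in>X. m p q k) \<le> (\<Sum>q\<in>S. \<Sum>k\<in>X. m p q k)"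
      using that by (intro member_le_sum \<open>finite S\<close> sum_nonneg m0) auto
    also have "\<dots> \<le> (\<Sum>p\<in>S. \<Sum>q\<in>S. \<Sum>k\<in>X. m p q k)"
      using that
      by (intro member_le_sum[of p S "\<lambda>p. \<Sum>q\<in>S. \<Sum>k\<in>X. m p q k"] \<open>finite S\<close> sum_nonneg m0) auto
    finally show ?thesis by (simp add: r_def)
  qed
  have "0 \<le> (\<Sum>p\<in>S. \<Sum>q\<in>S. \<Sum>k\<in>X. m p q k)" by (intro sum_nonneg m0) auto
  then have "0 < r" by (simp add: r_def)
  define Z where "Z = (\<lambda>(x, y). r *\<^sub>R x - y) ` S"
  have maxZ: "maximizes w Z (r *\<^sub>R x - y)"
    if xy: "(x, y) \<in> S" "maximizes w X x" "maximizes w Y y" for w x y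
    unfolding maximizes_def
  proof (intro conjI ballI)
    show "r *\<^sub>R x - y \<in> Z" using xy by (force simp: Z_def)
    fix z assume "z \<in> Z"
    then obtain x' y' where x'y': "(x', y') \<in> S" "z = r *\<^sub>R x' - y'" by (auto simp: Z_def)
    have "x' \<in> X" using sub x'y' by auto
    \<comment> \<open>The gain of \<open>y\<close> over \<open>y'\<close> is a nonnegative
      combination of the gains \<open>w \<bullet> (k - x')\<close>. None of these exceeds the gain
      of the maximiser \<open>x\<close>, so \<open>r\<close> times the latter suffices.\<close>
    have "w \<bullet> (y - y') = - (w \<bullet> (snd (x', y') - snd (x, y)))" by (simp add: inner_diff_right)
    also have "\<dots> = (\<Sum>k\<in>X. m (x', y') (x, y) k * (w \<bullet> (k - x')))"
      unfolding m[OF x'y'(1) xy(1)] inner_sum_right sum_negf[symmetric]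
      by (simp add: inner_diff_right algebra_simps)
    also have "\<dots> \<le> (\<Sum>k\<in>X. m (x', y') (x, y) k * (w \<bullet> (x - x')))"
      using xy m0[OF x'y'(1) xy(1)]
      by (intro sum_mono mult_left_mono) (auto simp: maximizes_def inner_diff_right)
    also have "\<dots> = (\<Sum>k\<in>X. m (x', y') (x, y) k) * (w \<bullet> (x - x'))"
      by (simp add: sum_distrib_right)
    also have "\<dots> \<le> r * (w \<bullet> (x - x'))"
      using xy x'y' \<open>x' \<in> X\<close>
      by (intro mult_right_mono r) (auto simp: maximizes_def inner_diff_right)
    finally show "w \<bullet> z \<le> w \<bullet> (r *\<^sub>R x - y)"
      by (simp add: x'y' inner_diff_right right_diff_distrib)
  qed
  have conv: "convex hull Y + convex hull Z = convex hull (Y + Z)"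
    by (simp add: convex_hull_set_plus)
  have fZ: "finite Z" "finite (Y + Z)"
    using \<open>finite S\<close> fin by (auto simp: Z_def finite_set_plus)
  have scale: "(\<lambda>x. r *\<^sub>R x) ` (convex hull X) = convex hull ((\<lambda>x. r *\<^sub>R x) ` X)"
    by (simp add: convex_hull_scaling)
  \<comment> \<open>In direction \<open>w\<close> both sides attain the same maximum, at
    \<open>r\<close> times \<open>x1\<close> and at its splitting into \<open>y1\<close> and the
    matching point of \<open>Z\<close>.\<close>
  have "(\<lambda>x. r *\<^sub>R x) ` (convex hull X) = convex hull Y + convex hull Z"
  proof
    show "(\<lambda>x. r *\<^sub>R x) ` (convex hull X) \<subseteq> convex hull Y + convex hull Z"
    proof (rule subset_if_support_le)
      show "convex (convex hull Y + convex hull Z)" "closed (convex hull Y + convex hull Z)"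
        using fZ by (auto simp: conv finite_imp_compact_convex_hull compact_imp_closed)
      fix w x assume "x \<in> (\<lambda>x. r *\<^sub>R x) ` (convex hull X)"
      then obtain x0 where x0: "x = r *\<^sub>R x0" "x0 \<in> convex hull X" by blast
      obtain x1 y1 where xy: "(x1, y1) \<in> S" "maximizes w X x1" "maximizes w Y y1"
        using cov[of w] by blast
      have "r *\<^sub>R x1 = y1 + (r *\<^sub>R x1 - y1)" by simp
      moreover have "y1 \<in> convex hull Y" "r *\<^sub>R x1 - y1 \<in> convex hull Z"
        using xy maxZ[OF xy] by (auto simp: maximizes_def hull_inc)
      ultimately have "r *\<^sub>R x1 \<in> convex hull Y + convex hull Z" by (metis set_plus_intro)
      moreover have "w \<bullet> x \<le> w \<bullet> (r *\<^sub>R x1)"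
        using maximizes_convex_hull[OF xy(2) x0(2)] \<open>0 < r\<close> by (simp add: x0)
      ultimately show "\<exists>y\<in>convex hull Y + convex hull Z. w \<bullet> x \<le> w \<bullet> y" by blast
    qed
    show "convex hull Y + convex hull Z \<subseteq> (\<lambda>x. r *\<^sub>R x) ` (convex hull X)"
    proof (rule subset_if_support_le)
      show "convex ((\<lambda>x. r *\<^sub>R x) ` (convex hull X))" "closed ((\<lambda>x. r *\<^sub>R x) ` (convex hull X))"
        using fin
        by (auto simp: scale finite_imp_compact_convex_hull compact_imp_closed)
      fix w x assume "x \<in> convex hull Y + convex hull Z"
      then obtain y z where yz: "x = y + z" "y \<in> convex hull Y" "z \<in> convex hull Z"
        by (auto elim: set_plus_elim)
      obtain x1 y1 where xy: "(x1, y1) \<in> S" "maximizes w X x1" "maximizes w Y y1"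
        using cov[of w] by blast
      have "w \<bullet> x \<le> w \<bullet> y1 + w \<bullet> (r *\<^sub>R x1 - y1)"
        using maximizes_convex_hull[OF xy(3) yz(2)] maximizes_convex_hull[OF maxZ[OF xy] yz(3)]
        by (simp add: yz inner_add_right)
      then have "w \<bullet> x \<le> w \<bullet> (r *\<^sub>R x1)" by (simp add: inner_diff_right)
      moreover have "x1 \<in> convex hull X" using xy by (simp add: maximizes_def hull_inc)
      ultimately show "\<exists>y\<in>(\<lambda>x. r *\<^sub>R x) ` (convex hull X). w \<bullet> x \<le> w \<bullet> y" by blast
    qed
  qed
  moreover have "Z \<noteq> {}" using cov[of 0] by (auto simp: Z_def)
  ultimately show ?thesis
    unfolding weak_minkowski_summand_def
    using fin fZ \<open>0 < r\<close>
    by (intro conjI exI[of _ r] exI[of _ "convex hull Z"]) (auto simp: polytope_convex_hull)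
qed

subsection \<open>Edges at a vertex\<close>

text \<open>Induction on the dimension: in dimension 1 the polytope is a segment ending at
  \<open>v\<close>; above that, \<open>v\<close> is a vertex of a facet of positive dimension, and
  edges of the facet are edges of \<open>P\<close>.\<close>

lemma edge_at_vertex:
  fixes P :: "'a::euclidean_space set"
  assumes "polytope P" and v: "v \<in> vertices P" and "P \<noteq> {v}"
  shows "\<exists>u\<in>vertices P. closed_segment u v edge_of P"
  using assms
proof (induction "nat (aff_dim P)" arbitrary: P rule: less_induct)
  case less
  have vP: "v \<in> P" using less.prems by (simp add: vertices_def extreme_point_of_def)
  have "aff_dim P \<noteq> -1" using vP aff_dim_empty[of P] by auto
  moreover have "aff_dim P \<noteq> 0" using vP less.prems(3) aff_dim_eq_0[of P] by auto
  moreover have "-1 \<le> aff_dim P" by (rule aff_dim_geq)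
  ultimately have dim: "1 \<le> aff_dim P" by linarith
  show ?case
  proof (cases "aff_dim P = 1")
    case True
    then have "collinear P" by (simp add: collinear_aff_dim)
    then obtain a b where ab: "P = closed_segment a b"
      using compact_convex_collinear_segment[of P] vP less.prems(1)
        polytope_imp_compact polytope_imp_convex by blast
    then have "v = a \<or> v = b"
      using v less.prems by (simp add: vertices_def extreme_point_of_segment)
    then obtain u where u: "P = closed_segment u v"
      using ab closed_segment_commute by metis
    then have "u \<in> vertices P" by (simp add: vertices_def extreme_point_of_segment)
    moreover have "closed_segment u v edge_of P"
      using True by (simp add: u edge_of_def face_of_refl)
    ultimately show ?thesis by blast
  next
    case False
    have face: "{v} face_of P" using less.prems by (simp add: vertices_def face_of_singleton)
    then obtain G where G: "G facet_of P" "{v} \<subseteq> G"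
      using face_of_polyhedron_subset_facet[of P "{v}"] less.prems polytope_imp_polyhedron
      by blast
    then have GP: "G face_of P" "aff_dim G = aff_dim P - 1" by (auto simp: facet_of_def)
    have "G \<noteq> {v}" using GP False dim by auto
    moreover have "polytope G" using GP less.prems face_of_polytope_polytope by blast
    moreover have "v \<in> vertices G"
      using G GP less.prems by (auto simp: vertices_def extreme_point_of_face)
    ultimately obtain u where u: "u \<in> vertices G" "closed_segment u v edge_of G"
      using less.hyps[of G] GP dim by auto
    then have "u \<in> vertices P" "closed_segment u v edge_of P"
      using GP face_of_trans by (auto simp: vertices_def extreme_point_of_face edge_of_def)
    then show ?thesis by blast
  qed
qed

lemma finite_vertices: "polytope P \<Longrightarrow> finite (vertices P)"
  by (simp add: vertices_def finite_polyhedron_extreme_points polytope_imp_polyhedron)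

lemma convex_hull_vertices: "polytope P \<Longrightarrow> P = convex hull vertices P"
  unfolding vertices_def
  by (intro Krein_Milman_Minkowski polytope_imp_compact polytope_imp_convex)

lemma vertices_subset: "vertices P \<subseteq> P"
  by (auto simp: vertices_def extreme_point_of_def)

text \<open>The simplex method's principle that a local optimum is global. The functional
  \<open>g\<close> is tilted by one exposing \<open>v\<close> until \<open>v\<close> just remains
  optimal; the optimal face then contains an edge at \<open>v\<close>, and \<open>g\<close>
  increases along it.\<close>

lemma improving_edge:
  fixes P :: "'a::euclidean_space set"
  assumes P: "polytope P" and v: "v \<in> vertices P" and x: "x \<in> P" "g \<bullet> v < g \<bullet> x"
  shows "\<exists>u\<in>vertices P. closed_segment u v edge_of P \<and> g \<bullet> v < g \<bullet> u"
proof -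
  have vP: "v \<in> P" using v vertices_subset by blast
  have "{v} exposed_face_of P"
    using exposed_face_of_polyhedron[OF polytope_imp_polyhedron[OF P]] v
    by (simp add: vertices_def face_of_singleton)
  then obtain a b where ab: "P \<subseteq> {x. a \<bullet> x \<le> b}" "{v} = P \<inter> {x. a \<bullet> x = b}"
    unfolding exposed_face_of_def by blast
  define h where "h y = a \<bullet> v - a \<bullet> y" for y
  have h: "0 < h y" if "y \<in> P" "y \<noteq> v" for y
  proof -
    have "a \<bullet> v = b" "a \<bullet> y \<le> b" "a \<bullet> y \<noteq> b" using ab that by auto
    then show ?thesis by (simp add: h_def)
  qed
  define V where "V = vertices P - {v}"
  have "finite V" using finite_vertices[OF P] by (simp add: V_def)
  have "V \<noteq> {}"
  proof
    assume "V = {}"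
    then have "vertices P = {v}" using v by (auto simp: V_def)
    then have "P = {v}" using convex_hull_vertices[OF P] by simp
    then show False using x by auto
  qed
  \<comment> \<open>The steepest ascent of \<open>g\<close> relative to \<open>h\<close>, the drop
    of the exposing functional; it is the least tilt that makes \<open>v\<close> optimal for
    \<open>f\<close>.\<close>
  define \<rho> where "\<rho> = Max ((\<lambda>y. (g \<bullet> (y - v)) / h y) ` V)"
  have hV: "0 < h y" if "y \<in> V" for y using h that vertices_subset by (auto simp: V_def)
  have le: "g \<bullet> (y - v) \<le> \<rho> * h y" if "y \<in> V" for y
  proof -
    have "(g \<bullet> (y - v)) / h y \<le> \<rho>" using that \<open>finite V\<close> by (simp add: \<rho>_def)
    then show ?thesis using hV[OF that] by (simp add: pos_divide_le_eq)
  qed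
  define f where "f = g + \<rho> *\<^sub>R a"
  have f: "f \<bullet> (y - v) = g \<bullet> (y - v) - \<rho> * h y" for y
    by (simp add: f_def h_def inner_add_left inner_diff_right algebra_simps)
  have "vertices P \<subseteq> {y. f \<bullet> y \<le> f \<bullet> v}"
  proof
    fix y assume "y \<in> vertices P"
    then show "y \<in> {y. f \<bullet> y \<le> f \<bullet> v}"
      using le[of y] f[of y] by (cases "y = v") (auto simp: V_def inner_diff_right)
  qed
  then have "convex hull (vertices P) \<subseteq> {y. f \<bullet> y \<le> f \<bullet> v}"
    by (intro hull_minimal) (auto simp: convex_halfspace_le)
  then have fle: "f \<bullet> y \<le> f \<bullet> v" if "y \<in> P" for y
    using convex_hull_vertices[OF P] that by auto
  \<comment> \<open>Otherwise optimality of \<open>v\<close> for \<open>f\<close> would give that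
    \<open>g\<close> does not increase from \<open>v\<close> to \<open>x\<close>.\<close>
  have "\<rho> > 0"
  proof (rule ccontr)
    have "x \<noteq> v" using x by auto
    assume "\<not> \<rho> > 0"
    then have "\<rho> * h x \<le> 0" using h[OF x(1) \<open>x \<noteq> v\<close>] by (simp add: mult_nonpos_nonneg)
    moreover have "g \<bullet> (x - v) \<le> \<rho> * h x" using fle[OF x(1)] f[of x] by (simp add: inner_diff_right)
    ultimately show False using x by (simp add: inner_diff_right)
  qed
  define F where "F = P \<inter> {y. f \<bullet> y = f \<bullet> v}"
  have F: "F face_of P"
    unfolding F_def using fle P
    by (intro face_of_Int_supporting_hyperplane_le) (auto simp: polytope_imp_convex)
  \<comment> \<open>The vertex attaining the maximum lies in \<open>F\<close>, so this face is
    larger than \<open>{v}\<close> and has an edge at \<open>v\<close>.\<close>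
  have "\<rho> \<in> (\<lambda>y. (g \<bullet> (y - v)) / h y) ` V"
    unfolding \<rho>_def using \<open>finite V\<close> \<open>V \<noteq> {}\<close> by (intro Max_in) auto
  then obtain y where y: "y \<in> V" "\<rho> = (g \<bullet> (y - v)) / h y" by blast
  then have "f \<bullet> (y - v) = 0" using hV[OF y(1)] by (simp add: f)
  then have "y \<in> F" using y vertices_subset by (auto simp: F_def V_def inner_diff_right)
  then have "F \<noteq> {v}" using y by (auto simp: V_def)
  moreover have "polytope F" using F P face_of_polytope_polytope by blast
  moreover have "v \<in> vertices F"
    using v vP F by (auto simp: vertices_def extreme_point_of_face F_def)
  ultimately obtain u where u: "u \<in> vertices F" "closed_segment u v edge_of F"
    using edge_at_vertex by blast
  have uP: "u \<in> vertices P" "closed_segment u v edge_of P"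
    using u F face_of_trans by (auto simp: vertices_def extreme_point_of_face edge_of_def)
  have "u \<noteq> v" using u by (auto simp: edge_of_def)
  have "f \<bullet> (u - v) = 0" using u vertices_subset by (auto simp: F_def inner_diff_right)
  then have "g \<bullet> (u - v) = \<rho> * h u" by (simp add: f)
  moreover have "0 < h u" using uP \<open>u \<noteq> v\<close> h vertices_subset by blast
  ultimately have "0 < g \<bullet> (u - v)" using \<open>\<rho> > 0\<close> by simp
  then show ?thesis using uP by (auto simp: inner_diff_right)
qed

lemma exists_max_vertex:
  fixes P :: "'a::euclidean_space set"
  assumes "polytope P" "P \<noteq> {}"
  shows "\<exists>v\<in>vertices P. \<forall>x\<in>P. c \<bullet> x \<le> c \<bullet> v"
proof -
  let ?V = "vertices P"
  have "?V \<noteq> {}" using convex_hull_vertices assms by fastforce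
  moreover have "finite ?V" using assms finite_vertices by blast
  ultimately obtain v where v: "v \<in> ?V" "\<forall>x\<in>?V. c \<bullet> x \<le> c \<bullet> v"
    using obtains_MAX[of ?V "\<lambda>x. c \<bullet> x"] by (metis Max_ge finite_imageI imageI)
  then have "convex hull ?V \<subseteq> {x. c \<bullet> x \<le> c \<bullet> v}"
    by (intro hull_minimal) (auto simp: convex_halfspace_le)
  then show ?thesis using v convex_hull_vertices assms(1) by blast
qed

text \<open>A second maximiser would make the \<open>c\<close>-maximal face larger than
  \<open>{v}\<close>, and an edge of this face at \<open>v\<close> would be an edge of
  \<open>P\<close> on which \<open>c\<close> is constant.\<close>

lemma unique_max_vertex:
  fixes P :: "'a::euclidean_space set"
  assumes P: "polytope P" and gen: "generic_for P c"
    and v: "v \<in> vertices P" "\<forall>x\<in>P. c \<bullet> x \<le> c \<bullet> v" and u: "u \<in> P" "c \<bullet> v \<le> c \<bullet> u"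
  shows "u = v"
proof (rule ccontr)
  assume "u \<noteq> v"
  define F where "F = P \<inter> {y. c \<bullet> y = c \<bullet> v}"
  have F: "F face_of P"
    unfolding F_def using v P
    by (intro face_of_Int_supporting_hyperplane_le) (auto simp: polytope_imp_convex)
  have "u \<in> F" using u v by (auto simp: F_def intro: antisym)
  moreover have "v \<in> vertices F"
    using v F vertices_subset by (auto simp: vertices_def extreme_point_of_face F_def extreme_point_of_def)
  ultimately obtain t where t: "t \<in> vertices F" "closed_segment t v edge_of F"
    using edge_at_vertex[of F v] \<open>u \<noteq> v\<close> face_of_polytope_polytope P F by blast
  then have "closed_segment t v edge_of P" using F face_of_trans by (auto simp: edge_of_def)
  moreover have "c \<bullet> t = c \<bullet> v" using t vertices_subset by (auto simp: F_def)
  ultimately show False using gen by (auto simp: generic_for_def)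
qed

subsection \<open>Steepest paths\<close>

text \<open>For endpoints of different height, \<open>c\<close> takes the value 1 on this vector, so
  its inner product with \<open>w\<close> is the slope of the edge projected by \<open>c\<close> and
  \<open>w\<close>.\<close>

definition edge_dir :: "'a::euclidean_space \<Rightarrow> 'a \<Rightarrow> 'a \<Rightarrow> 'a" where
  "edge_dir c v u = (1 / (c \<bullet> (u - v))) *\<^sub>R (u - v)"

text \<open>The signed area under the segment from \<open>p\<close> to \<open>q\<close> in the projection of the polytope to the
  plane by \<open>x \<mapsto> (c \<bullet> x, w \<bullet> x)\<close>.\<close>

definition trapezoid :: "'a::euclidean_space \<Rightarrow> 'a \<Rightarrow> 'a \<Rightarrow> 'a \<Rightarrow> real" where
  "trapezoid c w p q = (c \<bullet> q - c \<bullet> p) * (w \<bullet> p + w \<bullet> q) / 2"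

definition path_area :: "'a::euclidean_space \<Rightarrow> 'a \<Rightarrow> 'a list \<Rightarrow> real" where
  "path_area c w W = (\<Sum>i<length W - 1. trapezoid c w (W ! i) (W ! Suc i))"

text \<open>In direction \<open>w\<close>, the midpoints weighted by height differences become
  trapezoid areas.\<close>

lemma inner_path_point:
  assumes "W \<noteq> []"
  shows "w \<bullet> path_point c W = path_area c w W / (c \<bullet> last W - c \<bullet> hd W)"
proof -
  obtain k where k: "length W = Suc k" using assms by (cases W) auto
  have "w \<bullet> path_point c W =
    (\<Sum>i=1..<length W. trapezoid c w (W ! (i - 1)) (W ! i) / (c \<bullet> last W - c \<bullet> hd W))"
    unfolding path_point_def inner_sum_right
    by (rule sum.cong) (auto simp: trapezoid_def inner_add_right inner_diff_right add.commute mult.commute)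
  also have "\<dots> = (\<Sum>i<k. trapezoid c w (W ! i) (W ! Suc i) / (c \<bullet> last W - c \<bullet> hd W))"
    unfolding k One_nat_def sum.shift_bounds_Suc_ivl by (simp add: lessThan_atLeast0)
  finally show ?thesis by (simp add: path_area_def k sum_divide_distrib)
qed

locale generic_polytope =
  fixes P :: "'a::euclidean_space set" and c :: 'a
  assumes polytope_P: "polytope P" and nonempty_P: "P \<noteq> {}" and generic: "generic_for P c"
begin

abbreviation "V \<equiv> vertices P"
abbreviation "vopt \<equiv> opt_vertex P c"
abbreviation "vmin \<equiv> min_vertex P c"
abbreviation "Nb \<equiv> improving_nbs P c"
abbreviation "dir \<equiv> edge_dir c"

text \<open>Because of the normalisation, parallel improving edges contribute the same element.
  Injectivity on this set therefore excludes only ties between non-parallel edges.\<close>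

definition "dirs = {dir v u | v u. v \<in> V \<and> u \<in> Nb v}"
definition "pivot_point A = (\<Sum>v\<in>V - {vopt}. dir v (A v))"
definition "pivot_points = {pivot_point A | A. arborescence P c A}"
definition "path_points = {path_point c W | W. monotone_path P c W}"

lemma max_slope_polytope_eq: "max_slope_polytope P c = convex hull pivot_points"
  by (simp add: max_slope_polytope_def pivot_points_def pivot_point_def edge_dir_def)

lemma monotone_path_polytope_eq: "monotone_path_polytope P c = convex hull path_points"
  by (simp add: monotone_path_polytope_def path_points_def)

lemma finite_V: "finite V"
  by (rule finite_vertices[OF polytope_P])

lemma V_subset: "v \<in> V \<Longrightarrow> v \<in> P"
  using vertices_subset by blast

lemma vopt: "vopt \<in> V" "\<And>x. x \<in> P \<Longrightarrow> c \<bullet> x \<le> c \<bullet> vopt"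
proof -
  have "\<exists>!v. v \<in> V \<and> (\<forall>x\<in>P. c \<bullet> x \<le> c \<bullet> v)"
    using exists_max_vertex[OF polytope_P nonempty_P, of c]
      unique_max_vertex[OF polytope_P generic] V_subset by metis
  from theI'[OF this] show "vopt \<in> V" "\<And>x. x \<in> P \<Longrightarrow> c \<bullet> x \<le> c \<bullet> vopt"
    unfolding opt_vertex_def by auto
qed

lemma less_opt: "x \<in> P \<Longrightarrow> x \<noteq> vopt \<Longrightarrow> c \<bullet> x < c \<bullet> vopt"
  using unique_max_vertex[OF polytope_P generic vopt(1), of x] vopt(2) by force

lemma vmin: "vmin \<in> V" "\<And>x. x \<in> P \<Longrightarrow> c \<bullet> vmin \<le> c \<bullet> x"
proof -
  have "generic_for P (- c)" using generic by (simp add: generic_for_def)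
  then have "\<exists>!v. v \<in> V \<and> (\<forall>x\<in>P. (- c) \<bullet> x \<le> (- c) \<bullet> v)"
    using exists_max_vertex[OF polytope_P nonempty_P, of "- c"]
      unique_max_vertex[OF polytope_P, of "- c"] V_subset by metis
  then have "\<exists>!v. v \<in> V \<and> (\<forall>x\<in>P. c \<bullet> v \<le> c \<bullet> x)" by simp
  from theI'[OF this] show "vmin \<in> V" "\<And>x. x \<in> P \<Longrightarrow> c \<bullet> vmin \<le> c \<bullet> x"
    unfolding min_vertex_def by auto
qed

lemma Nb_nonempty: "v \<in> V - {vopt} \<Longrightarrow> Nb v \<noteq> {}"
  using improving_edge[OF polytope_P, of v vopt c] less_opt[of v] vopt V_subset
  by (auto simp: improving_nbs_def)

lemma Nb: "u \<in> Nb v \<Longrightarrow> u \<in> V \<and> c \<bullet> v < c \<bullet> u"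
  by (simp add: improving_nbs_def)

lemma inner_dir: "c \<bullet> u \<noteq> c \<bullet> v \<Longrightarrow> w \<bullet> (u - v) = (w \<bullet> dir v u) * (c \<bullet> (u - v))"
  by (simp add: edge_dir_def inner_diff_right)

definition "steepest w A \<longleftrightarrow> arborescence P c A \<and>
  (\<forall>v\<in>V - {vopt}. \<forall>u\<in>Nb v. w \<bullet> dir v u \<le> w \<bullet> dir v (A v))"

lemma arborescence_Nb:
  "arborescence P c A \<Longrightarrow> v \<in> V - {vopt} \<Longrightarrow> A v \<in> Nb v"
  by (simp add: arborescence_def)

text \<open>The pivot point is a sum of independent contributions of the vertices, and redirecting
  an arborescence at a single vertex to another improving neighbour gives an arborescence
  again.\<close>

lemma steepest_iff_maximizes:
  assumes A: "arborescence P c A"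
  shows "maximizes w pivot_points (pivot_point A) \<longleftrightarrow> steepest w A"
proof
  assume max: "maximizes w pivot_points (pivot_point A)"
  show "steepest w A"
    unfolding steepest_def
  proof (intro conjI ballI)
    fix v u assume v: "v \<in> V - {vopt}" and u: "u \<in> Nb v"
    let ?A = "A(v := u)"
    have "arborescence P c ?A" using A u v by (auto simp: arborescence_def)
    then have "w \<bullet> pivot_point ?A \<le> w \<bullet> pivot_point A"
      using max by (auto simp: maximizes_def pivot_points_def)
    moreover have "pivot_point B = dir v (B v) + (\<Sum>y\<in>V - {vopt} - {v}. dir y (B y))" for B
      unfolding pivot_point_def using v finite_V by (intro sum.remove) auto
    moreover have "(\<Sum>y\<in>V - {vopt} - {v}. dir y (?A y)) = (\<Sum>y\<in>V - {vopt} - {v}. dir y (A y))"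
      by (intro sum.cong) auto
    ultimately show "w \<bullet> dir v u \<le> w \<bullet> dir v (A v)"
      by (simp add: inner_add_right)
  qed (rule A)
next
  assume "steepest w A"
  then have "w \<bullet> pivot_point B \<le> w \<bullet> pivot_point A" if "arborescence P c B" for B
    unfolding pivot_point_def inner_sum_right
    using that by (intro sum_mono) (auto simp: steepest_def arborescence_Nb)
  then show "maximizes w pivot_points (pivot_point A)"
    using A by (auto simp: maximizes_def pivot_points_def)
qed

lemma exists_steepest: "\<exists>A. steepest w A"
proof -
  have "\<exists>u. v \<in> V - {vopt} \<longrightarrow> u \<in> Nb v \<and> (\<forall>t\<in>Nb v. w \<bullet> dir v t \<le> w \<bullet> dir v u)" for v
  proof (cases "v \<in> V - {vopt}")
    case True
    have "finite (Nb v)" using finite_V by (rule rev_finite_subset) (auto simp: improving_nbs_def)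
    then show ?thesis
      using obtains_MAX[OF _ Nb_nonempty[OF True], of "\<lambda>u. w \<bullet> dir v u"]
      by (metis Max_ge finite_imageI imageI)
  next
    case False
    then show ?thesis by blast
  qed
  then have "\<exists>A. \<forall>v. v \<in> V - {vopt} \<longrightarrow>
      A v \<in> Nb v \<and> (\<forall>t\<in>Nb v. w \<bullet> dir v t \<le> w \<bullet> dir v (A v))"
    by (intro choice allI)
  then obtain A where A: "\<forall>v. v \<in> V - {vopt} \<longrightarrow>
      A v \<in> Nb v \<and> (\<forall>t\<in>Nb v. w \<bullet> dir v t \<le> w \<bullet> dir v (A v))"
    by (elim exE)
  \<comment> \<open>The choice leaves the value at \<open>vopt\<close> arbitrary, but an
    arborescence must fix this vertex.\<close>
  have "steepest w (A(vopt := vopt))"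
    using A by (auto simp: steepest_def arborescence_def)
  then show ?thesis by blast
qed

lemma path_step: "monotone_path P c W \<Longrightarrow> Suc i < length W \<Longrightarrow> W ! Suc i \<in> Nb (W ! i)"
  by (force simp: monotone_path_def)

lemma path_vertex: "monotone_path P c W \<Longrightarrow> i < length W \<Longrightarrow> W ! i \<in> V"
  by (auto simp: monotone_path_def)

lemma path_hd: "monotone_path P c W \<Longrightarrow> W ! 0 = vmin"
  by (auto simp: monotone_path_def hd_conv_nth)

lemma path_last: "monotone_path P c W \<Longrightarrow> W ! (length W - 1) = vopt"
  by (auto simp: monotone_path_def last_conv_nth)

lemma path_increasing:
  assumes W: "monotone_path P c W" and "i < j" "j < length W"
  shows "c \<bullet> W ! i < c \<bullet> W ! j"
  using assms(2,3)
proof (induction j)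
  case (Suc j)
  have "c \<bullet> W ! j < c \<bullet> W ! Suc j" using Nb[OF path_step[OF W]] Suc.prems by blast
  then show ?case using Suc by (cases "i = j") auto
qed simp

text \<open>Strict increase of \<open>c\<close> forbids repeated vertices, which bounds the length
  of a path.\<close>

lemma finite_path_points: "finite path_points"
proof -
  have "W \<in> {W. set W \<subseteq> V \<and> length W \<le> card V}" if W: "monotone_path P c W" for W
  proof -
    have "distinct W"
      unfolding distinct_conv_nth using path_increasing[OF W] by (metis linorder_neqE_nat less_irrefl)
    then show ?thesis
      using W finite_V by (auto simp: monotone_path_def distinct_card[symmetric] card_mono)
  qed
  then have "path_points \<subseteq> path_point c ` {W. set W \<subseteq> V \<and> length W \<le> card V}"
    unfolding path_points_def by blast
  then show ?thesis
    using finite_lists_length_le[OF finite_V] finite_subset by blast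
qed

lemma finite_pivot_points: "finite pivot_points"
proof -
  \<comment> \<open>Arborescences are arbitrary outside \<open>V\<close>; only their restrictions to
    \<open>V\<close> range over a finite set.\<close>
  have "pivot_point A \<in> pivot_point ` (V \<rightarrow>\<^sub>E V)" if A: "arborescence P c A" for A
  proof
    show "restrict A V \<in> V \<rightarrow>\<^sub>E V"
    proof (intro restrict_PiE_iff[THEN iffD2] ballI)
      fix v assume "v \<in> V"
      then show "A v \<in> V"
        using A Nb[OF arborescence_Nb[OF A, of v]] vopt(1)
        by (cases "v = vopt") (auto simp: arborescence_def)
    qed
    show "pivot_point A = pivot_point (restrict A V)"
      unfolding pivot_point_def by (intro sum.cong) auto
  qed
  then have "pivot_points \<subseteq> pivot_point ` (V \<rightarrow>\<^sub>E V)" by (auto simp: pivot_points_def)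
  then show ?thesis
    using finite_PiE[of V "\<lambda>_. V"] finite_V finite_subset by blast
qed

definition "follows A W \<longleftrightarrow>
  monotone_path P c W \<and> (\<forall>i. Suc i < length W \<longrightarrow> W ! Suc i = A (W ! i))"

text \<open>Iterating \<open>A\<close> from \<open>vmin\<close> strictly increases \<open>c\<close>
  until \<open>vopt\<close> is reached, which must happen because \<open>V\<close> is
  finite.\<close>

lemma exists_follows:
  assumes A: "arborescence P c A"
  shows "\<exists>W. follows A W"
proof -
  define x where "x i = (A ^^ i) vmin" for i
  have xV: "x i \<in> V" for i
  proof (induction i)
    case 0
    show ?case by (simp add: x_def vmin)
  next
    case (Suc i)
    then show ?case
      using A Nb[OF arborescence_Nb[OF A, of "x i"]] vopt(1)
      by (cases "x i = vopt") (auto simp: arborescence_def x_def)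
  qed
  have step: "x (Suc i) \<in> Nb (x i)" if "x i \<noteq> vopt" for i
    using arborescence_Nb[OF A, of "x i"] that xV by (simp add: x_def)
  have ex: "\<exists>n. x n = vopt"
  proof (rule ccontr)
    assume "\<not> ?thesis"
    then have "strict_mono (\<lambda>i. c \<bullet> x i)" using step Nb by (simp add: strict_mono_Suc_iff)
    then have "inj x" using strict_mono_imp_inj_on[of "\<lambda>i. c \<bullet> x i" UNIV] by (auto simp: inj_on_def)
    moreover have "finite (range x)" using xV finite_V by (auto intro: finite_subset)
    ultimately show False using finite_imageD by blast
  qed
  \<comment> \<open>The first hitting time: every earlier step is improving, whereas
    \<open>A\<close> stays put at \<open>vopt\<close>.\<close>
  define n where "n = (LEAST n. x n = vopt)"
  have n: "x n = vopt" "\<And>i. i < n \<Longrightarrow> x i \<noteq> vopt"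
    unfolding n_def by (rule LeastI_ex[OF ex], rule not_less_Least)
  define W where "W = map x [0..<Suc n]"
  have W: "length W = Suc n" "\<And>i. i \<le> n \<Longrightarrow> W ! i = x i"
    by (auto simp: W_def simp del: upt_Suc)
  have "W \<noteq> []" using W by auto
  moreover have "set W \<subseteq> V" using xV by (auto simp: W_def)
  moreover have "hd W = vmin" using W \<open>W \<noteq> []\<close> by (simp add: hd_conv_nth x_def)
  moreover have "last W = vopt" using W n \<open>W \<noteq> []\<close> by (simp add: last_conv_nth)
  moreover have "W ! i \<in> Nb (W ! (i - 1))" if "i \<in> {1..<length W}" for i
    using that step[of "i - 1"] n(2)[of "i - 1"] by (auto simp: W)
  ultimately have "monotone_path P c W" by (simp add: monotone_path_def)
  moreover have "W ! Suc i = A (W ! i)" if "Suc i < length W" for i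
    using that by (simp add: W) (simp add: x_def)
  ultimately show ?thesis by (auto simp: follows_def)
qed

abbreviation "slope w W i \<equiv> w \<bullet> dir (W ! i) (W ! Suc i)"

lemma slope_eq:
  assumes "monotone_path P c W" "Suc i < length W"
  shows "w \<bullet> (W ! Suc i - W ! i) = slope w W i * (c \<bullet> (W ! Suc i - W ! i))"
  by (rule inner_dir) (use path_increasing[OF assms(1), of i "Suc i"] assms(2) in simp)

text \<open>At each vertex of a steepest path the supporting line bounds the backward edges, because the
  slopes decrease, and the forward edges, because of the choice of the path; hence it bounds \<open>P\<close>.\<close>

lemma steepest_tangent:
  assumes A: "steepest w A" and F: "follows A W" and "Suc i < length W" and "x \<in> P"
  shows "w \<bullet> (x - W ! i) \<le> slope w W i * (c \<bullet> (x - W ! i))"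
  using assms(3,4)
proof (induction i arbitrary: x rule: less_induct)
  case (less i x)
  have W: "monotone_path P c W" and Wi: "W ! Suc i = A (W ! i)"
    using F less.prems by (auto simp: follows_def)
  let ?v = "W ! i" and ?s = "slope w W i"
  have v: "?v \<in> V" "W ! Suc i \<in> Nb ?v"
    using path_vertex[OF W] path_step[OF W] less.prems by auto
  then have "c \<bullet> ?v < c \<bullet> vopt" using Nb vopt V_subset by fastforce
  then have v_opt: "?v \<in> V - {vopt}" using v by auto
  show ?case
  proof (rule ccontr)
    assume neg: "\<not> ?thesis"
    \<comment> \<open>The functional \<open>g\<close> measures height relative to lines of slope
      \<open>?s\<close>. A point above the tangent at \<open>?v\<close> thus yields an edge at
      \<open>?v\<close> leading above it.\<close>
    define g where "g = w - ?s *\<^sub>R c"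
    have "g \<bullet> ?v < g \<bullet> x" using neg by (simp add: g_def inner_diff_left inner_diff_right algebra_simps)
    then obtain u where u: "u \<in> V" "closed_segment u ?v edge_of P" "g \<bullet> ?v < g \<bullet> u"
      using improving_edge[OF polytope_P v(1) less.prems(2)] by blast
    then have gu: "?s * (c \<bullet> (u - ?v)) < w \<bullet> (u - ?v)"
      by (simp add: g_def inner_diff_left inner_diff_right algebra_simps)
    have "c \<bullet> u \<noteq> c \<bullet> ?v" using u(2) generic by (simp add: generic_for_def)
    then consider "c \<bullet> ?v < c \<bullet> u" | "c \<bullet> u < c \<bullet> ?v" by linarith
    then show False
    proof cases
      case 1
      then have "w \<bullet> dir ?v u \<le> ?s"
        using A v_opt u unfolding Wi by (auto simp: steepest_def improving_nbs_def)
      then have "(w \<bullet> dir ?v u) * (c \<bullet> (u - ?v)) \<le> ?s * (c \<bullet> (u - ?v))"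
        using 1 by (intro mult_right_mono) (auto simp: inner_diff_right)
      moreover have "w \<bullet> (u - ?v) = (w \<bullet> dir ?v u) * (c \<bullet> (u - ?v))"
        using 1 by (intro inner_dir) auto
      ultimately show False using gu by simp
    next
      case 2
      \<comment> \<open>The path starts at the minimum, so a lower neighbour can exist only at a
        later vertex, which has a preceding path edge.\<close>
      then have "i \<noteq> 0" using path_hd[OF W] vmin(2)[of u] u V_subset by (metis not_le)
      then obtain j where j: "i = Suc j" by (cases i) auto
      let ?r = "slope w W j"
      \<comment> \<open>The supporting line of the previous edge also passes through its end
        \<open>W ! i\<close>. Evaluated at the next vertex it gives \<open>?s \<le> ?r\<close>; on
        the backward side the line of smaller slope lies higher.\<close>
      have tangent: "w \<bullet> (y - W ! i) \<le> ?r * (c \<bullet> (y - W ! i))" if "y \<in> P" for y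
        using less.IH[of j y] slope_eq[OF W, of j w] that less.prems j
        by (simp add: inner_diff_right algebra_simps)
      have "?s * (c \<bullet> (W ! Suc i - ?v)) \<le> ?r * (c \<bullet> (W ! Suc i - ?v))"
        using tangent[of "W ! Suc i"] slope_eq[OF W, of i w] v Nb V_subset less.prems by auto
      moreover have "0 < c \<bullet> (W ! Suc i - ?v)" using v Nb by (simp add: inner_diff_right)
      ultimately have "?s \<le> ?r" by simp
      then have "?r * (c \<bullet> (u - ?v)) \<le> ?s * (c \<bullet> (u - ?v))"
        using 2 by (intro mult_right_mono_neg) (auto simp: inner_diff_right)
      then show False using tangent[of u] gu u V_subset by fastforce
    qed
  qed
qed

text \<open>The supporting line of an edge passes through both of its endpoints.\<close>

lemma steepest_tangent_end:
  assumes "steepest w A" and F: "follows A W" and i: "Suc i < length W" and "x \<in> P"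
  shows "w \<bullet> (x - W ! Suc i) \<le> slope w W i * (c \<bullet> (x - W ! Suc i))"
proof -
  have "monotone_path P c W" using F by (simp add: follows_def)
  then show ?thesis
    using steepest_tangent[OF assms] slope_eq[OF _ i, of w]
    by (simp add: inner_diff_right algebra_simps)
qed

text \<open>The supporting line of each edge bounds the end of the following edge from
  above.\<close>

lemma steepest_slopes_antimono:
  assumes A: "steepest w A" and F: "follows A W" and "i \<le> j" "Suc j < length W"
  shows "slope w W j \<le> slope w W i"
proof (rule antimono_upto[where n = "length W - 1"])
  fix i assume "Suc i < length W - 1"
  then have i: "Suc (Suc i) < length W" by simp
  have W: "monotone_path P c W" using F by (simp add: follows_def)
  have "W ! Suc (Suc i) \<in> P" using path_vertex[OF W i] V_subset by blast
  from steepest_tangent_end[OF A F _ this, of i] i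
  have "slope w W (Suc i) * (c \<bullet> (W ! Suc (Suc i) - W ! Suc i))
      \<le> slope w W i * (c \<bullet> (W ! Suc (Suc i) - W ! Suc i))"
    using slope_eq[OF W i, of w] by simp
  moreover have "c \<bullet> W ! Suc i < c \<bullet> W ! Suc (Suc i)" using path_increasing[OF W _ i] by simp
  ultimately show "slope w W (Suc i) \<le> slope w W i" by (simp add: inner_diff_right)
qed (use assms in auto)

subsection \<open>Areas under paths\<close>

lemma exists_on_segment:
  assumes "p \<in> P" "q \<in> P" "c \<bullet> p < c \<bullet> q" "t \<in> {c \<bullet> p..c \<bullet> q}"
  shows "\<exists>x\<in>P. c \<bullet> x = t \<and> w \<bullet> x = w \<bullet> p + (w \<bullet> dir p q) * (t - c \<bullet> p)"
proof -
  define \<alpha> where "\<alpha> = (t - c \<bullet> p) / (c \<bullet> (q - p))"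
  have d: "0 < c \<bullet> (q - p)" using assms by (simp add: inner_diff_right)
  have "0 \<le> \<alpha>" "\<alpha> \<le> 1" using d assms by (auto simp: \<alpha>_def inner_diff_right)
  then have "p + \<alpha> *\<^sub>R (q - p) \<in> P"
    using convexD_alt[OF polytope_imp_convex[OF polytope_P] assms(1,2), of \<alpha>]
    by (simp add: algebra_simps)
  moreover have "c \<bullet> (p + \<alpha> *\<^sub>R (q - p)) = t" using d by (simp add: inner_add_right \<alpha>_def)
  moreover have "w \<bullet> (p + \<alpha> *\<^sub>R (q - p)) = w \<bullet> p + (w \<bullet> dir p q) * (t - c \<bullet> p)"
    using d by (simp add: inner_add_right \<alpha>_def edge_dir_def)
  ultimately show ?thesis by blast
qed

lemma trapezoid_has_integral:
  assumes "c \<bullet> p < c \<bullet> q"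
  shows "((\<lambda>t. w \<bullet> p + (w \<bullet> dir p q) * (t - c \<bullet> p)) has_integral trapezoid c w p q)
    {c \<bullet> p..c \<bullet> q}"
proof -
  have "w \<bullet> p + (w \<bullet> dir p q) * (c \<bullet> q - c \<bullet> p) = w \<bullet> q"
    using inner_dir[of q p w] assms by (simp add: inner_diff_right)
  then show ?thesis
    using has_integral_affine[of "c \<bullet> p" "c \<bullet> q" "w \<bullet> p" "w \<bullet> dir p q"] assms
    by (simp add: trapezoid_def)
qed

text \<open>The chord is the projection of points of \<open>P\<close>, so it lies below
  \<open>G\<close>; the segment from \<open>p\<close> to \<open>q\<close> need not be an
  edge.\<close>

lemma trapezoid_le_integral:
  assumes G: "continuous_on UNIV G" "\<And>x. x \<in> P \<Longrightarrow> w \<bullet> x \<le> G (c \<bullet> x)"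
    and pq: "p \<in> P" "q \<in> P" "c \<bullet> p < c \<bullet> q"
  shows "trapezoid c w p q \<le> integral {c \<bullet> p..c \<bullet> q} G"
proof (rule has_integral_le[OF trapezoid_has_integral[OF pq(3)]])
  show "(G has_integral integral {c \<bullet> p..c \<bullet> q} G) {c \<bullet> p..c \<bullet> q}"
    using G(1) by (intro integrable_integral integrable_continuous_interval)
      (auto intro: continuous_on_subset)
  show "w \<bullet> p + (w \<bullet> dir p q) * (t - c \<bullet> p) \<le> G t" if "t \<in> {c \<bullet> p..c \<bullet> q}" for t
    using exists_on_segment[OF pq that, of w] G(2) by metis
qed

text \<open>Stated for a stretch of the path, so that the parts before and after a shortcut can be
  bounded separately.\<close>

lemma sum_trapezoid_le_integral:
  assumes G: "continuous_on UNIV G" "\<And>x. x \<in> P \<Longrightarrow> w \<bullet> x \<le> G (c \<bullet> x)"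
    and W: "monotone_path P c W" and "a \<le> b" "b < length W"
  shows "(\<Sum>i=a..<b. trapezoid c w (W ! i) (W ! Suc i)) \<le> integral {c \<bullet> W ! a..c \<bullet> W ! b} G"
  using assms(4,5)
proof (induction b rule: dec_induct)
  case (step b)
  have "c \<bullet> W ! a \<le> c \<bullet> W ! b"
    using path_increasing[OF W, of a b] step by (cases "a = b") auto
  moreover have b: "c \<bullet> W ! b < c \<bullet> W ! Suc b" using path_increasing[OF W] step by simp
  ultimately have "integral {c \<bullet> W ! a..c \<bullet> W ! b} G + integral {c \<bullet> W ! b..c \<bullet> W ! Suc b} G
      = integral {c \<bullet> W ! a..c \<bullet> W ! Suc b} G"
    using G(1) by (intro Henstock_Kurzweil_Integration.integral_combine integrable_continuous_interval)
      (auto intro: continuous_on_subset)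
  moreover have "trapezoid c w (W ! b) (W ! Suc b) \<le> integral {c \<bullet> W ! b..c \<bullet> W ! Suc b} G"
    using b path_vertex[OF W] V_subset step by (intro trapezoid_le_integral G) auto
  ultimately show ?case using step by simp
qed simp

lemma path_area_le_integral:
  assumes "continuous_on UNIV G" "\<And>x. x \<in> P \<Longrightarrow> w \<bullet> x \<le> G (c \<bullet> x)"
    and W: "monotone_path P c W"
  shows "path_area c w W \<le> integral {c \<bullet> vmin..c \<bullet> vopt} G"
proof -
  have "W \<noteq> []" using W by (simp add: monotone_path_def)
  then show ?thesis
    using sum_trapezoid_le_integral[OF assms, of 0 "length W - 1"] path_hd[OF W] path_last[OF W]
    by (simp add: path_area_def lessThan_atLeast0)
qed

text \<open>\<open>G\<close> is the upper boundary of the projection of \<open>P\<close> to the plane by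
  \<open>x \<mapsto> (c \<bullet> x, w \<bullet> x)\<close>, as a minimum of tangents.\<close>

lemma steepest_path_area:
  assumes A: "steepest w A" and F: "follows A W" and ne: "vmin \<noteq> vopt"
  obtains G where "continuous_on UNIV G" "\<And>x. x \<in> P \<Longrightarrow> w \<bullet> x \<le> G (c \<bullet> x)"
    "path_area c w W = integral {c \<bullet> vmin..c \<bullet> vopt} G"
proof -
  have W: "monotone_path P c W" using F by (simp add: follows_def)
  define n where "n = length W - 1"
  have "W \<noteq> []" using W by (simp add: monotone_path_def)
  have "n \<noteq> 0" using path_hd[OF W] path_last[OF W] ne by (auto simp: n_def)
  have len: "length W = Suc n" using \<open>W \<noteq> []\<close> by (simp add: n_def)
  define L where "L i t = w \<bullet> W ! i + slope w W i * (t - c \<bullet> W ! i)" for i t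
  define G where "G t = Min ((\<lambda>i. L i t) ` {..<n})" for t
  have cont: "continuous_on UNIV G"
    unfolding G_def L_def using \<open>n \<noteq> 0\<close> by (intro continuous_on_Min continuous_intros) auto
  have dom: "w \<bullet> x \<le> G (c \<bullet> x)" if "x \<in> P" for x
  proof -
    have "w \<bullet> x \<le> L i (c \<bullet> x)" if "i < n" for i
      using steepest_tangent[OF A F _ \<open>x \<in> P\<close>, of i] that len
      by (simp add: L_def inner_diff_right algebra_simps)
    then show ?thesis unfolding G_def using \<open>n \<noteq> 0\<close> by (subst Min_ge_iff) auto
  qed
  have step: "integral {c \<bullet> W ! i..c \<bullet> W ! Suc i} G = trapezoid c w (W ! i) (W ! Suc i)"
    if i: "i < n" for i
  proof -
    have inc: "c \<bullet> W ! i < c \<bullet> W ! Suc i" using path_increasing[OF W] i len by simp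
    have in_P: "W ! i \<in> P" "W ! Suc i \<in> P" using path_vertex[OF W] V_subset i len by auto
    \<comment> \<open>Above its own edge the tangent \<open>L i\<close> is the least one: its points
      there come from \<open>P\<close>, which all tangents dominate.\<close>
    have "G t = L i t" if t: "t \<in> {c \<bullet> W ! i..c \<bullet> W ! Suc i}" for t
    proof (rule antisym)
      show "G t \<le> L i t" using i by (simp add: G_def)
      show "L i t \<le> G t" unfolding L_def using exists_on_segment[OF in_P inc t, of w] dom by metis
    qed
    then have "integral {c \<bullet> W ! i..c \<bullet> W ! Suc i} G = integral {c \<bullet> W ! i..c \<bullet> W ! Suc i} (L i)"
      by (intro Henstock_Kurzweil_Integration.integral_cong) auto
    also have "\<dots> = trapezoid c w (W ! i) (W ! Suc i)"
      unfolding L_def by (intro integral_unique trapezoid_has_integral inc)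
    finally show ?thesis .
  qed
  have "(\<Sum>i<k. trapezoid c w (W ! i) (W ! Suc i)) = integral {c \<bullet> W ! 0..c \<bullet> W ! k} G"
    if "k \<le> n" for k
    using that
  proof (induction k)
    case (Suc k)
    have "c \<bullet> W ! 0 \<le> c \<bullet> W ! k" "c \<bullet> W ! k \<le> c \<bullet> W ! Suc k"
      using path_increasing[OF W, of 0 k] path_increasing[OF W, of k "Suc k"] Suc.prems len
      by (cases "k = 0"; simp)+
    then have "integral {c \<bullet> W ! 0..c \<bullet> W ! k} G + integral {c \<bullet> W ! k..c \<bullet> W ! Suc k} G
        = integral {c \<bullet> W ! 0..c \<bullet> W ! Suc k} G"
      using cont
      by (intro Henstock_Kurzweil_Integration.integral_combine integrable_continuous_interval)
        (auto intro: continuous_on_subset)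
    then show ?case using Suc step by simp
  qed simp
  then have "path_area c w W = integral {c \<bullet> vmin..c \<bullet> vopt} G"
    using path_hd[OF W] path_last[OF W] by (simp add: path_area_def len)
  with cont dom show ?thesis using that by blast
qed

lemma inner_monotone_path_point:
  "monotone_path P c W \<Longrightarrow> w \<bullet> path_point c W = path_area c w W / (c \<bullet> vopt - c \<bullet> vmin)"
  by (simp add: inner_path_point monotone_path_def)

text \<open>The area under the upper boundary bounds the area of every monotone path, and a steepest
  path attains it.\<close>

lemma steepest_path_maximizes:
  assumes A: "steepest w A" and F: "follows A W"
  shows "maximizes w path_points (path_point c W)"
proof -
  have W: "monotone_path P c W" using F by (simp add: follows_def)
  have "w \<bullet> path_point c U \<le> w \<bullet> path_point c W" if U: "monotone_path P c U" for U
  proof (cases "vmin = vopt")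
    \<comment> \<open>Here the normalising denominator is 0, so both inner products vanish.\<close>
    case True
    then show ?thesis using U W by (simp add: inner_monotone_path_point)
  next
    case False
    have "path_area c w U \<le> path_area c w W"
      using steepest_path_area[OF A F False] path_area_le_integral[OF _ _ U] by metis
    moreover have "c \<bullet> vmin \<le> c \<bullet> vopt" using vmin vopt V_subset by blast
    ultimately show ?thesis
      using U W by (simp add: inner_monotone_path_point divide_right_mono)
  qed
  then show ?thesis using W by (auto simp: maximizes_def path_points_def)
qed

text \<open>An increase of the slopes would allow a shortcut enlarging the area under the path.\<close>

lemma maximal_path_slopes_antimono:
  assumes W: "monotone_path P c W" and max: "maximizes w path_points (path_point c W)"
    and "i \<le> j" "Suc j < length W"
  shows "slope w W j \<le> slope w W i"
proof (rule antimono_upto[where n = "length W - 1"])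
  fix i assume "Suc i < length W - 1"
  then have i: "Suc (Suc i) < length W" by simp
  \<comment> \<open>A steepest path for \<open>w\<close> supplies the upper boundary
    \<open>G\<close>; maximality of \<open>W\<close> forces the area of \<open>W\<close> to reach
    the integral of \<open>G\<close>.\<close>
  obtain A where A: "steepest w A" using exists_steepest by blast
  then obtain U where U: "follows A U" using exists_follows steepest_def by blast
  let ?n = "length W - 1" and ?T = "\<lambda>i. trapezoid c w (W ! i) (W ! Suc i)"
  have inc: "c \<bullet> W ! i < c \<bullet> W ! Suc i" "c \<bullet> W ! Suc i < c \<bullet> W ! Suc (Suc i)"
    using path_increasing[OF W] i by auto
  have "c \<bullet> W ! Suc (Suc i) \<le> c \<bullet> vopt" "c \<bullet> vmin \<le> c \<bullet> W ! i"
    using path_vertex[OF W] V_subset vopt vmin i by auto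
  then have lt: "c \<bullet> vmin < c \<bullet> vopt" using inc by linarith
  then have "vmin \<noteq> vopt" by auto
  from steepest_path_area[OF A U this] obtain G where G: "continuous_on UNIV G"
    "\<And>x. x \<in> P \<Longrightarrow> w \<bullet> x \<le> G (c \<bullet> x)" "path_area c w U = integral {c \<bullet> vmin..c \<bullet> vopt} G"
    by blast
  have "monotone_path P c U" using U by (simp add: follows_def)
  moreover from this have "w \<bullet> path_point c U \<le> w \<bullet> path_point c W"
    using max by (auto simp: maximizes_def path_points_def)
  ultimately have "path_area c w U \<le> path_area c w W"
    using W lt by (simp add: inner_monotone_path_point divide_le_cancel)
  also have "path_area c w W = (\<Sum>k=0..<i. ?T k) + ?T i + ?T (Suc i) + (\<Sum>k=Suc (Suc i)..<?n. ?T k)"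
  proof -
    have "(\<Sum>k=0..<?n. ?T k) = (\<Sum>k=0..<Suc (Suc i). ?T k) + (\<Sum>k=Suc (Suc i)..<?n. ?T k)"
      using i by (intro sum.atLeastLessThan_concat[symmetric]) auto
    then show ?thesis by (simp add: path_area_def lessThan_atLeast0)
  qed
  also have "(\<Sum>k=0..<i. ?T k) \<le> integral {c \<bullet> W ! 0..c \<bullet> W ! i} G"
    using i by (intro sum_trapezoid_le_integral G W) auto
  also have "(\<Sum>k=Suc (Suc i)..<?n. ?T k) \<le> integral {c \<bullet> W ! Suc (Suc i)..c \<bullet> W ! ?n} G"
    using i by (intro sum_trapezoid_le_integral G W) auto
  finally have le: "integral {c \<bullet> vmin..c \<bullet> vopt} G \<le> integral {c \<bullet> vmin..c \<bullet> W ! i} G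
      + ?T i + ?T (Suc i) + integral {c \<bullet> W ! Suc (Suc i)..c \<bullet> vopt} G"
    using G(3) path_hd[OF W] path_last[OF W] by simp
  have comb: "integral {a..b} G + integral {b..d} G = integral {a..d} G" if "a \<le> b" "b \<le> d" for a b d
    using G(1) that
    by (intro Henstock_Kurzweil_Integration.integral_combine integrable_continuous_interval)
      (auto intro: continuous_on_subset)
  \<comment> \<open>The shortcut skips \<open>W ! Suc i\<close>. It need not be an edge, but its
    chord lies in \<open>P\<close> and hence below \<open>G\<close>.\<close>
  have "trapezoid c w (W ! i) (W ! Suc (Suc i))
      \<le> integral {c \<bullet> W ! i..c \<bullet> W ! Suc (Suc i)} G"
    using inc path_vertex[OF W] V_subset i by (intro trapezoid_le_integral G) auto
  moreover have "integral {c \<bullet> vmin..c \<bullet> vopt} G = integral {c \<bullet> vmin..c \<bullet> W ! i} G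
      + integral {c \<bullet> W ! i..c \<bullet> W ! Suc (Suc i)} G + integral {c \<bullet> W ! Suc (Suc i)..c \<bullet> vopt} G"
    using comb[of "c \<bullet> vmin" "c \<bullet> W ! i" "c \<bullet> vopt"]
      comb[of "c \<bullet> W ! i" "c \<bullet> W ! Suc (Suc i)" "c \<bullet> vopt"] inc
      \<open>c \<bullet> W ! Suc (Suc i) \<le> c \<bullet> vopt\<close> \<open>c \<bullet> vmin \<le> c \<bullet> W ! i\<close> by linarith
  ultimately have "trapezoid c w (W ! i) (W ! Suc (Suc i)) \<le> ?T i + ?T (Suc i)"
    using le by linarith
  moreover define a where "a = c \<bullet> (W ! Suc i - W ! i)"
  moreover define b where "b = c \<bullet> (W ! Suc (Suc i) - W ! Suc i)"
  moreover have "w \<bullet> (W ! Suc i - W ! i) = slope w W i * a"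
    "w \<bullet> (W ! Suc (Suc i) - W ! Suc i) = slope w W (Suc i) * b"
    using slope_eq[OF W, of i w] slope_eq[OF W, of "Suc i" w] i by (simp_all add: a_def b_def)
  \<comment> \<open>The area gained by the shortcut is a triangle, computed by a cross
    product.\<close>
  moreover have "2 * (trapezoid c w (W ! i) (W ! Suc (Suc i)) - ?T i - ?T (Suc i))
      = a * (w \<bullet> (W ! Suc (Suc i) - W ! Suc i)) - b * (w \<bullet> (W ! Suc i - W ! i))"
    by (simp add: trapezoid_def a_def b_def inner_diff_right field_simps)
  ultimately have "0 \<ge> (a * b) * (slope w W (Suc i) - slope w W i)"
    by (simp add: algebra_simps)
  moreover have "0 < a * b" using inc by (simp add: a_def b_def inner_diff_right)
  ultimately show "slope w W (Suc i) \<le> slope w W i" by (smt (verit) mult_pos_pos)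
qed (use assms in auto)

end

subsection \<open>Zonotopes\<close>

lemma mem_closed_segment_minus:
  "x \<in> closed_segment (- z) z \<longleftrightarrow> (\<exists>l. -1 \<le> l \<and> l \<le> 1 \<and> x = l *\<^sub>R z)" for z :: "'a::real_vector"
proof
  assume "x \<in> closed_segment (- z) z"
  then obtain a where "0 \<le> a" "a \<le> 1" "x = (1 - a) *\<^sub>R (- z) + a *\<^sub>R z"
    by (auto simp: closed_segment_def)
  then show "\<exists>l. -1 \<le> l \<and> l \<le> 1 \<and> x = l *\<^sub>R z"
    by (intro exI[of _ "2 * a - 1"]) (simp add: algebra_simps flip: scaleR_add_left)
next
  assume "\<exists>l. -1 \<le> l \<and> l \<le> 1 \<and> x = l *\<^sub>R z"
  then obtain l where l: "-1 \<le> l" "l \<le> 1" "x = l *\<^sub>R z" by blast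
  have "x = (1 - (l + 1) / 2) *\<^sub>R (- z) + ((l + 1) / 2) *\<^sub>R z"
    unfolding l(3) scaleR_minus_right scaleR_minus_left[symmetric] scaleR_add_left[symmetric]
    by (simp add: field_simps)
  then show "x \<in> closed_segment (- z) z"
    using l unfolding closed_segment_def by (intro CollectI exI[of _ "(l + 1) / 2"]) auto
qed

lemma zonotope_coordinates:
  assumes "zonotope P"
  shows "\<exists>(n::nat) z t. \<forall>x.
    x \<in> P \<longleftrightarrow> (\<exists>l. (\<forall>i<n. -1 \<le> l i \<and> l i \<le> 1) \<and> x = t + (\<Sum>i<n. l i *\<^sub>R z i))"
proof -
  obtain n z t where P: "P = (+) t ` (\<Sum>i<n::nat. closed_segment (- z i) (z i))"
    using assms unfolding zonotope_def by blast
  have "x \<in> P \<longleftrightarrow> (\<exists>l. (\<forall>i<n. -1 \<le> l i \<and> l i \<le> 1) \<and> x = t + (\<Sum>i<n. l i *\<^sub>R z i))" for x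
  proof
    assume "x \<in> P"
    then obtain s where s: "x = t + sum s {..<n}" "\<forall>i<n. s i \<in> closed_segment (- z i) (z i)"
      by (auto simp: P set_sum_alt)
    then have "\<forall>i. \<exists>l. i < n \<longrightarrow> -1 \<le> l \<and> l \<le> 1 \<and> s i = l *\<^sub>R z i"
      by (auto simp: mem_closed_segment_minus)
    from choice[OF this] obtain l where
      l: "\<forall>i. i < n \<longrightarrow> -1 \<le> l i \<and> l i \<le> 1 \<and> s i = l i *\<^sub>R z i" by blast
    then have "sum s {..<n} = (\<Sum>i<n. l i *\<^sub>R z i)" by (intro sum.cong) auto
    then show "\<exists>l. (\<forall>i<n. -1 \<le> l i \<and> l i \<le> 1) \<and> x = t + (\<Sum>i<n. l i *\<^sub>R z i)"
      using s l by auto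
  next
    assume "\<exists>l. (\<forall>i<n. -1 \<le> l i \<and> l i \<le> 1) \<and> x = t + (\<Sum>i<n. l i *\<^sub>R z i)"
    then obtain l where l: "\<forall>i<n. -1 \<le> l i \<and> l i \<le> 1" "x = t + (\<Sum>i<n. l i *\<^sub>R z i)" by blast
    then have "\<forall>i\<in>{..<n}. l i *\<^sub>R z i \<in> closed_segment (- z i) (z i)"
      by (auto simp: mem_closed_segment_minus)
    then have "(\<Sum>i<n. l i *\<^sub>R z i) \<in> (\<Sum>i<n. closed_segment (- z i) (z i))"
      unfolding set_sum_alt[OF finite_lessThan] by blast
    then show "x \<in> P" by (simp add: P l)
  qed
  then show ?thesis by (intro exI allI)
qed

text \<open>The edge is parallel to some generator \<open>z k\<close>, on which \<open>g\<close>
  therefore vanishes and \<open>c\<close> does not. Moving the \<open>k\<close>-th coordinate of any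
  \<open>g\<close>-maximiser from one end of its range to the other stays in the
  \<open>g\<close>-maximal face and changes \<open>c\<close>.\<close>

lemma zonotope_edge_shift:
  fixes P :: "'a::euclidean_space set"
  assumes zon: "zonotope P" and P: "polytope P" and e: "closed_segment u v edge_of P"
    and g: "g \<bullet> (u - v) = 0" and c: "c \<bullet> (u - v) \<noteq> 0"
  shows "\<exists>x\<in>P. \<exists>y\<in>P. c \<bullet> x < c \<bullet> y \<and> g \<bullet> y = g \<bullet> x \<and> (\<forall>p\<in>P. g \<bullet> p \<le> g \<bullet> x)"
proof -
  obtain n :: nat and z t where mem_all: "\<forall>x.
    x \<in> P \<longleftrightarrow> (\<exists>l. (\<forall>i<n. -1 \<le> l i \<and> l i \<le> 1) \<and> x = t + (\<Sum>i<n. l i *\<^sub>R z i))"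
    using zonotope_coordinates[OF zon] by (elim exE)
  note mem = mem_all[rule_format]
  have shift: "t + (\<Sum>i<n. l i *\<^sub>R z i) + (m - l k) *\<^sub>R z k \<in> P"
    if l: "\<forall>i<n. -1 \<le> l i \<and> l i \<le> 1" and k: "k < n" and m: "-1 \<le> m" "m \<le> 1" for l m k
  proof -
    have "(\<Sum>i<n. ((l(k := m)) i - l i) *\<^sub>R z i) = (\<Sum>i<n. if i = k then (m - l k) *\<^sub>R z k else 0)"
      by (intro sum.cong) auto
    also have "\<dots> = (m - l k) *\<^sub>R z k" using k by simp
    finally have "t + (\<Sum>i<n. l i *\<^sub>R z i) + (m - l k) *\<^sub>R z k = t + (\<Sum>i<n. (l(k := m)) i *\<^sub>R z i)"
      by (simp add: scaleR_left_diff_distrib sum_subtractf algebra_simps)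
    then show ?thesis
      unfolding mem using l m by (intro exI[of _ "l(k := m)"]) auto
  qed
  have face: "closed_segment u v face_of P" using e by (simp add: edge_of_def)
  have "u \<in> P" "v \<in> P" using face_of_imp_subset[OF face] by auto
  then obtain l m where l: "\<forall>i<n. -1 \<le> l i \<and> l i \<le> 1" "u = t + (\<Sum>i<n. l i *\<^sub>R z i)"
    and m: "\<forall>i<n. -1 \<le> m i \<and> m i \<le> 1" "v = t + (\<Sum>i<n. m i *\<^sub>R z i)"
    unfolding mem by blast
  have "u \<noteq> v" using c by auto
  then have "(\<Sum>i<n. l i *\<^sub>R z i) \<noteq> (\<Sum>i<n. m i *\<^sub>R z i)" by (simp add: l(2) m(2))
  then have "\<exists>k\<in>{..<n}. l k *\<^sub>R z k \<noteq> m k *\<^sub>R z k" by (rule contrapos_np) (intro sum.cong refl, blast)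
  then obtain k where k: "k < n" "l k *\<^sub>R z k \<noteq> m k *\<^sub>R z k" by auto
  then have "l k \<noteq> m k" "z k \<noteq> 0" by auto
  \<comment> \<open>These are coordinates of the midpoint \<open>q\<close> of the edge. Resetting
    only coordinate \<open>k\<close> to \<open>l k\<close> or \<open>m k\<close> gives points
    \<open>a\<close> and \<open>b\<close> of \<open>P\<close> with midpoint \<open>q\<close>; as the
    edge is a face, both lie on it, so \<open>z k\<close> is parallel to it.\<close>
  define r where "r i = (l i + m i) / 2" for i
  have r: "\<forall>i<n. -1 \<le> r i \<and> r i \<le> 1" using l m by (fastforce simp: r_def)
  define q where "q = t + (\<Sum>i<n. r i *\<^sub>R z i)"
  have "2 * r i = l i + m i" for i by (simp add: r_def)
  then have "2 *\<^sub>R (\<Sum>i<n. r i *\<^sub>R z i) = (\<Sum>i<n. l i *\<^sub>R z i) + (\<Sum>i<n. m i *\<^sub>R z i)"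
    by (simp add: scaleR_sum_right flip: sum.distrib scaleR_left_distrib)
  then have "2 *\<^sub>R q = u + v" by (simp add: q_def l(2) m(2) scaleR_add_right scaleR_2)
  then have q: "q = midpoint u v" by (simp add: midpoint_def flip: \<open>2 *\<^sub>R q = u + v\<close>)
  define a where "a = q + (l k - r k) *\<^sub>R z k"
  define b where "b = q + (m k - r k) *\<^sub>R z k"
  have "a \<in> P" "b \<in> P" using shift[OF r k(1)] l m k by (auto simp: a_def b_def q_def)
  have ab: "a - b = (l k - m k) *\<^sub>R z k"
    by (simp add: a_def b_def scaleR_left_diff_distrib)
  then have "a \<noteq> b" using \<open>l k \<noteq> m k\<close> \<open>z k \<noteq> 0\<close> by auto
  have "a + b = 2 *\<^sub>R q + ((l k - r k) + (m k - r k)) *\<^sub>R z k"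
    by (simp only: a_def b_def scaleR_2 scaleR_add_left ac_simps)
  moreover have "(l k - r k) + (m k - r k) = 0" by (simp add: r_def field_simps)
  ultimately have "a + b = 2 *\<^sub>R q" by simp
  then have "q = midpoint a b" by (simp add: midpoint_def)
  then have "q \<in> open_segment a b" using \<open>a \<noteq> b\<close> by simp
  then have "a \<in> closed_segment u v" "b \<in> closed_segment u v"
    using face_ofD[OF face _ \<open>a \<in> P\<close> \<open>b \<in> P\<close>, of q] q by auto
  then obtain \<alpha> \<beta> where
    \<alpha>\<beta>: "a = (1 - \<alpha>) *\<^sub>R u + \<alpha> *\<^sub>R v" "b = (1 - \<beta>) *\<^sub>R u + \<beta> *\<^sub>R v"
    unfolding closed_segment_def by blast
  have "a - b = (\<beta> - \<alpha>) *\<^sub>R (u - v)" unfolding \<alpha>\<beta> by (simp add: algebra_simps)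
  then have dir: "(l k - m k) *\<^sub>R z k = (\<beta> - \<alpha>) *\<^sub>R (u - v)" by (simp only: ab)
  then have "\<beta> \<noteq> \<alpha>" using \<open>l k \<noteq> m k\<close> \<open>z k \<noteq> 0\<close> by auto
  have inner: "(l k - m k) * (w \<bullet> z k) = (\<beta> - \<alpha>) * (w \<bullet> (u - v))" for w
    using arg_cong[OF dir, of "inner w"] by simp
  have gz: "g \<bullet> z k = 0" using inner[of g] g \<open>l k \<noteq> m k\<close> by simp
  have cz: "c \<bullet> z k \<noteq> 0"
    using inner[of c] c \<open>\<beta> \<noteq> \<alpha>\<close> by (metis eq_iff_diff_eq_0 mult_eq_0_iff)
  obtain p where p: "p \<in> P" "\<forall>x\<in>P. g \<bullet> x \<le> g \<bullet> p"
    using exists_max_vertex[OF P, of g] \<open>u \<in> P\<close> vertices_subset by blast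
  obtain h where h: "\<forall>i<n. -1 \<le> h i \<and> h i \<le> 1" "p = t + (\<Sum>i<n. h i *\<^sub>R z i)"
    using p(1) unfolding mem by blast
  define x where "x s = p + (s - h k) *\<^sub>R z k" for s
  have "x s \<in> P" if "-1 \<le> s" "s \<le> 1" for s
    unfolding x_def h(2) using shift[OF h(1) k(1) that] .
  then have "x 1 \<in> P" "x (-1) \<in> P" by simp_all
  moreover have "g \<bullet> x s = g \<bullet> p" for s by (simp add: x_def inner_add_right gz)
  moreover have "c \<bullet> x 1 - c \<bullet> x (-1) = 2 * (c \<bullet> z k)"
    by (simp add: x_def inner_add_right algebra_simps)
  then have "c \<bullet> x 1 < c \<bullet> x (-1) \<or> c \<bullet> x (-1) < c \<bullet> x 1" using cz by linarith
  ultimately show ?thesis using p(2) by metis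
qed

context generic_polytope
begin

text \<open>A regular steepest path runs through the face of \<open>P\<close> maximising \<open>w - s *\<^sub>R c\<close>, where \<open>s\<close> is the
  slope of the given direction; this face is not contained in a level set of \<open>c\<close>.\<close>

lemma steepest_path_contains_dir:
  assumes zon: "zonotope P"
    and A: "steepest w A" and reg: "inj_on (\<lambda>d. w \<bullet> d) dirs" and F: "follows A W"
    and v: "v \<in> V" and u: "u \<in> Nb v"
  shows "\<exists>i. Suc i < length W \<and> dir (W ! i) (W ! Suc i) = dir v u"
proof (rule ccontr)
  assume none: "\<not> ?thesis"
  have W: "monotone_path P c W" using F by (simp add: follows_def)
  define s where "s = w \<bullet> dir v u"
  define g where "g = w - s *\<^sub>R c"
  have neq: "slope w W i \<noteq> s" if i: "Suc i < length W" for i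
  proof -
    have "dir (W ! i) (W ! Suc i) \<in> dirs"
      using path_vertex[OF W, of i] path_step[OF W i] i by (auto simp: dirs_def)
    moreover have "dir v u \<in> dirs" using v u by (auto simp: dirs_def)
    ultimately show ?thesis using reg none i by (auto simp: inj_on_def s_def)
  qed
  have "c \<bullet> v < c \<bullet> u" using Nb[OF u] by simp
  then have "g \<bullet> (u - v) = 0" "c \<bullet> (u - v) \<noteq> 0"
    using inner_dir[of u v w] by (simp_all add: g_def s_def inner_diff_left) (simp add: inner_diff_right)
  moreover have "closed_segment u v edge_of P" using u by (simp add: improving_nbs_def)
  ultimately obtain x y where xy: "x \<in> P" "y \<in> P" "c \<bullet> x < c \<bullet> y" "g \<bullet> y = g \<bullet> x"
    and max: "\<And>p. p \<in> P \<Longrightarrow> g \<bullet> p \<le> g \<bullet> x"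
    using zonotope_edge_shift[OF zon polytope_P] by blast
  have g: "g \<bullet> (p - q) = w \<bullet> (p - q) - s * (c \<bullet> (p - q))" for p q
    by (simp add: g_def inner_diff_left)
  \<comment> \<open>Past the start of an edge of slope below \<open>s\<close>, the tangent makes
    \<open>g\<close> strictly smaller than at that start, so the maximiser \<open>y\<close> cannot
    lie there. Symmetrically, \<open>x\<close> cannot lie before the end of an edge of slope above
    \<open>s\<close>.\<close>
  have lower: "c \<bullet> y \<le> c \<bullet> W ! i" if i: "Suc i < length W" and "slope w W i < s" for i
  proof (rule ccontr)
    assume "\<not> ?thesis"
    then have "slope w W i * (c \<bullet> (y - W ! i)) < s * (c \<bullet> (y - W ! i))"
      using that by (intro mult_strict_right_mono) (auto simp: inner_diff_right)
    then have "g \<bullet> (y - W ! i) < 0" using steepest_tangent[OF A F i xy(2)] by (simp add: g)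
    moreover have "W ! i \<in> P" using path_vertex[OF W] V_subset i by simp
    ultimately show False using max[of "W ! i"] xy by (simp add: inner_diff_right)
  qed
  have upper: "c \<bullet> W ! Suc i \<le> c \<bullet> x" if i: "Suc i < length W" and "s < slope w W i" for i
  proof (rule ccontr)
    assume "\<not> ?thesis"
    then have "slope w W i * (c \<bullet> (x - W ! Suc i)) < s * (c \<bullet> (x - W ! Suc i))"
      using that by (intro mult_strict_right_mono_neg) (auto simp: inner_diff_right)
    then have "g \<bullet> (x - W ! Suc i) < 0" using steepest_tangent_end[OF A F i xy(1)] by (simp add: g)
    moreover have "W ! Suc i \<in> P" using path_vertex[OF W] V_subset i by simp
    ultimately show False using max[of "W ! Suc i"] by (simp add: inner_diff_right)
  qed
  \<comment> \<open>An edge of slope below \<open>s\<close> would have to start at height at least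
    that of \<open>y\<close>, hence above \<open>x\<close>. So all edges have slope above
    \<open>s\<close> and end no higher than \<open>x\<close>, which keeps even \<open>vopt\<close>
    below \<open>y\<close>.\<close>
  have above: "c \<bullet> W ! i \<le> c \<bullet> x" if "i < length W" for i
    using that
  proof (induction i)
    case 0
    then show ?case using path_hd[OF W] vmin(2) xy by simp
  next
    case (Suc i)
    have "\<not> slope w W i < s" using lower[of i] Suc xy(3) by fastforce
    then have "s < slope w W i" using neq[of i] Suc.prems by simp
    then show ?case using upper Suc.prems by simp
  qed
  have "W \<noteq> []" using W by (simp add: monotone_path_def)
  then have "c \<bullet> vopt \<le> c \<bullet> x" using above[of "length W - 1"] path_last[OF W] by simp
  then show False using vopt(2)[OF xy(2)] xy(3) by simp
qed

section \<open>Matching maximisers and the two summand relations\<close>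

text \<open>This is the relation \<open>S\<close> for \<open>weak_minkowski_summandI\<close>; its
  converse serves for zonotopes. Regularity of the common direction makes the order of the slopes on
  \<open>dirs\<close> strict.\<close>

definition "regular_pairs = {(pivot_point A, path_point c W) | A W.
  \<exists>w. steepest w A \<and> inj_on (\<lambda>d. w \<bullet> d) dirs \<and> follows A W}"

lemma regular_pairs_subset: "regular_pairs \<subseteq> pivot_points \<times> path_points"
  by (auto simp: regular_pairs_def pivot_points_def path_points_def steepest_def follows_def)

text \<open>A regular perturbation \<open>w'\<close> preserves the strict inequalities of
  \<open>w\<close> between slopes, so a choice that is steepest for \<open>w'\<close> is steepest
  for \<open>w\<close> as well.\<close>

lemma regular_pairs_cover:
  "\<exists>(x, y)\<in>regular_pairs. maximizes w pivot_points x \<and> maximizes w path_points y"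
proof -
  have "dirs \<subseteq> (\<lambda>(v, u). dir v u) ` (V \<times> V)" using Nb by (auto simp: dirs_def)
  then have "finite dirs" using finite_V finite_subset by blast
  from exists_regular_perturbation[OF this, of w] obtain w' where
    reg: "inj_on (\<lambda>d. w' \<bullet> d) dirs"
    and w': "\<And>d e. d \<in> dirs \<Longrightarrow> e \<in> dirs \<Longrightarrow> w \<bullet> d < w \<bullet> e \<Longrightarrow> w' \<bullet> d < w' \<bullet> e"
    by blast
  obtain A where A: "steepest w' A" using exists_steepest by blast
  then have arb: "arborescence P c A" by (simp add: steepest_def)
  obtain W where W: "follows A W" using exists_follows[OF arb] by blast
  have "w \<bullet> dir v u \<le> w \<bullet> dir v (A v)" if vu: "v \<in> V - {vopt}" "u \<in> Nb v" for v u
  proof (rule ccontr)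
    assume "\<not> ?thesis"
    moreover have "dir v u \<in> dirs" "dir v (A v) \<in> dirs"
      using vu arborescence_Nb[OF arb] by (auto simp: dirs_def)
    ultimately have "w' \<bullet> dir v (A v) < w' \<bullet> dir v u" using w' by simp
    then show False using A vu by (force simp: steepest_def)
  qed
  then have "steepest w A" using arb by (simp add: steepest_def)
  then have "maximizes w pivot_points (pivot_point A)" "maximizes w path_points (path_point c W)"
    using steepest_iff_maximizes[OF arb] steepest_path_maximizes W by auto
  moreover have "(pivot_point A, path_point c W) \<in> regular_pairs"
    using A reg W by (auto simp: regular_pairs_def)
  ultimately show ?thesis by blast
qed

lemma maximizes_path_point:
  assumes "(x, y) \<in> regular_pairs" "maximizes w pivot_points x"
  shows "maximizes w path_points y"
proof -
  obtain A W where "x = pivot_point A" "y = path_point c W" "arborescence P c A" "follows A W"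
    using assms(1) by (auto simp: regular_pairs_def steepest_def)
  then show ?thesis using assms(2) steepest_iff_maximizes steepest_path_maximizes by simp
qed

lemma maximizes_pivot_point:
  assumes zon: "zonotope P" and xy: "(x, y) \<in> regular_pairs" and max: "maximizes w path_points y"
  shows "maximizes w pivot_points x"
proof -
  obtain A W w' where x: "x = pivot_point A" and y: "y = path_point c W"
    and A: "steepest w' A" and reg: "inj_on (\<lambda>d. w' \<bullet> d) dirs" and F: "follows A W"
    using xy by (auto simp: regular_pairs_def)
  have arb: "arborescence P c A" using A by (simp add: steepest_def)
  have W: "monotone_path P c W" using F by (simp add: follows_def)
  have "w \<bullet> dir v u \<le> w \<bullet> dir v (A v)" if v: "v \<in> V - {vopt}" and u: "u \<in> Nb v" for v u
  proof -
    have Av: "A v \<in> Nb v" using arborescence_Nb[OF arb v] .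
    obtain i where i: "Suc i < length W" "dir (W ! i) (W ! Suc i) = dir v (A v)"
      using steepest_path_contains_dir[OF zon A reg F _ Av] v by blast
    obtain j where j: "Suc j < length W" "dir (W ! j) (W ! Suc j) = dir v u"
      using steepest_path_contains_dir[OF zon A reg F _ u] v by blast
    show ?thesis
    \<comment> \<open>If the direction chosen by \<open>A\<close> comes first on \<open>W\<close>,
      the \<open>w\<close>-slopes, decreasing by maximality, settle the claim. Otherwise both
      directions have the same \<open>w'\<close>-slope and coincide by regularity.\<close>
    proof (cases "i \<le> j")
      case True
      then show ?thesis using maximal_path_slopes_antimono[OF W, of w i j] max i j y by simp
    next
      case False
      then have "w' \<bullet> dir v (A v) \<le> w' \<bullet> dir v u"
        using steepest_slopes_antimono[OF A F, of j i] i j by simp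
      moreover have "w' \<bullet> dir v u \<le> w' \<bullet> dir v (A v)" using A v u by (simp add: steepest_def)
      moreover have "dir v u \<in> dirs" "dir v (A v) \<in> dirs" using v u Av by (auto simp: dirs_def)
      ultimately have "dir v u = dir v (A v)" using reg by (simp add: inj_on_def)
      then show ?thesis by simp
    qed
  qed
  then have "steepest w A" using arb by (simp add: steepest_def)
  then show ?thesis using steepest_iff_maximizes[OF arb] x by simp
qed

lemma monotone_path_summand_max_slope:
  "weak_minkowski_summand (monotone_path_polytope P c) (max_slope_polytope P c)"
  unfolding monotone_path_polytope_eq max_slope_polytope_eq
  using finite_pivot_points finite_path_points regular_pairs_subset regular_pairs_cover
    maximizes_path_point
  by (rule weak_minkowski_summandI)

lemma max_slope_summand_monotone_path:
  assumes "zonotope P"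
  shows "weak_minkowski_summand (max_slope_polytope P c) (monotone_path_polytope P c)"
  unfolding monotone_path_polytope_eq max_slope_polytope_eq
proof (rule weak_minkowski_summandI)
  show "regular_pairs\<inverse> \<subseteq> path_points \<times> pivot_points" using regular_pairs_subset by auto
  show "\<exists>(x, y)\<in>regular_pairs\<inverse>. maximizes w path_points x \<and> maximizes w pivot_points y" for w
    using regular_pairs_cover[of w] by auto
  show "maximizes w pivot_points y"
    if "(x, y) \<in> regular_pairs\<inverse>" "maximizes w path_points x" for w x y
    using that maximizes_pivot_point[OF assms] by auto
qed (rule finite_path_points finite_pivot_points)+

end

theorem theorem1p6:
  fixes P :: "'a::euclidean_space set" and c :: 'a
  assumes "polytope P" and "P \<noteq> {}" and "generic_for P c"
  shows "weak_minkowski_summand (monotone_path_polytope P c) (max_slope_polytope P c) \<and>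
         (zonotope P \<longrightarrow>
            normally_equivalent (monotone_path_polytope P c) (max_slope_polytope P c))"
proof -
  interpret generic_polytope P c using assms by unfold_locales
  show ?thesis
    unfolding normally_equivalent_def
    using monotone_path_summand_max_slope max_slope_summand_monotone_path by blast
qed

end
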